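(* Let $\rho$ be an $n$-qubit density operator, $O$ a Hermitian observable, and consider the parametrized circuit $$U(\vec\theta)=\prod_{l=1}^M V_l e^{-i\theta_{\mathcal S(l)}H_l}=V_1e^{-i\theta_{\mathcal S(1)}H_1}\cdots V_Me^{-i\theta_{\mathcal S(M)}H_M},$$ with fixed unitaries $V_l$, Hermitian generators $H_l$, independent parameters $\vec\theta=(\theta_1,\dots,\theta_m)\in\mathbb{R}^m$ ($m\le M$) and a surjective map $\mathcal S:\{1,\dots,M\}\to\{1,\dots,m\}$ assigning to each generator its parameter (so parameters may be shared arbitrarily). Let $\mathcal{L}(\vec\theta)=\operatorname{Tr}[U(\vec\theta)\rho U^\dagger(\vec\theta)O]$. Fix $\vec\phi\in\mathbb{R}^m$ and any $p\in\{1,\dots,m\}$. Define $c_p(\vec\phi)=\big|\frac{\partial^2\mathcal{L}}{\partial\theta_p^2}(\vec\phi)\big|$ and, for each $q$, $\omega^{(\max)}_q=\sum_{l\in\mathcal S^{-1}(q)}\big(\lambda_{\max}(H_l)-\lambda_{\min}(H_l)\big)$. Let $$r_{\mathrm{patch}}^2:=\frac{9c_p(\vec\phi)^2}{8\Big(16c_p(\vec\phi)\|O\|_\infty(\omega^{(\max)}_p)^2\sum_{q\ne p}(\omega^{(\max)}_q)^2+32\|O\|_\infty^2(\omega^{(\max)}_p)^6\Big)}.$$ Then for every $r>0$ with $r^2\le r_{\mathrm{patch}}^2$, $$\operatorname{Var}_{\vec\theta\sim\mathcal{U}(\vec\phi,r)}[\mathcal{L}(\vec\theta)]\ge\frac{r^4}{45}\left(\Big(c_p(\vec\phi)-\tfrac83\|O\|_\infty(\omega^{(\max)}_p)^2\Big(\sum_{q\ne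 p}(\omega^{(\max)}_q)^2\Big)r^2\Big)^2-\tfrac{32}{3}\|O\|_\infty^2(\omega^{(\max)}_p)^6r^2\right),$$ and $$\operatorname{Var}_{\vec\theta\sim\mathcal{U}(\vec\phi,r_{\mathrm{patch}})}[\mathcal{L}(\vec\theta)]\ge\frac{1}{72}c_p(\vec\phi)^2r_{\mathrm{patch}}^4.$$ Finally, for a family of such instances indexed by $n$ with $\|O\|_\infty,\|H_k\|_\infty\in\mathcal{O}(\mathrm{poly}(n))$ and $c_p(\vec\phi)\in\Omega(1/\mathrm{poly}(n))$, choosing $r\in\Theta\big(1/(\mathrm{poly}(n)\sqrt m)\big)$ gives $\operatorname{Var}_{\vec\theta\sim\mathcal{U}(\vec\phi,r)}[\mathcal{L}(\vec\theta)]\in\Omega\big(1/(\mathrm{poly}(n)m^2)\big)$.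
   Context: $\|\cdot\|_\infty$ is the operator norm; $\lambda_{\max},\lambda_{\min}$ are the largest and smallest eigenvalues. $\mathcal S^{-1}(q)$ is the set of generator indices $l$ with $\mathcal S(l)=q$. For $\vec\phi\in\mathbb{R}^m$, $r>0$, $\mathcal{U}(\vec\phi,r)$ is the uniform distribution over $\{\vec\theta:\theta_i\in[\phi_i-r,\phi_i+r]\ \forall i\}$.
   Formalization: In the final family claim it is additionally assumed that the number of generators sharing any one parameter, |S^{-1}(q)|, is polynomially bounded in n (the claim fails otherwise), and "choosing r" is read as: some r in Θ(1/(poly(n)√m)) gives the stated variance bound. *)

theory Defs
  imports "Jordan_Normal_Form.Schur_Decomposition" "Jordan_Normal_Form.Char_Poly"
          "HOL-Probability.Probability"
begin

definition mtrace :: "complex mat \<Rightarrow> complex" where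
  "mtrace A = (\<Sum>i<dim_row A. A $$ (i,i))"

definition hermitian :: "complex mat \<Rightarrow> bool" where
  "hermitian A \<longleftrightarrow> A \<in> carrier_mat (dim_row A) (dim_row A) \<and> mat_adjoint A = A"

definition unitary :: "complex mat \<Rightarrow> bool" where
  "unitary A \<longleftrightarrow> A \<in> carrier_mat (dim_row A) (dim_row A) \<and>
     A * mat_adjoint A = 1\<^sub>m (dim_row A) \<and> mat_adjoint A * A = 1\<^sub>m (dim_row A)"

definition density_op :: "nat \<Rightarrow> complex mat \<Rightarrow> bool" where
  "density_op n \<rho> \<longleftrightarrow> \<rho> \<in> carrier_mat (2^n) (2^n) \<and> hermitian \<rho> \<and>
     (\<forall>v\<in>carrier_vec (2^n). 0 \<le> Re ((\<rho> *\<^sub>v v) \<bullet>c v)) \<and> mtrace \<rho> = 1"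

definition vnorm :: "complex Matrix.vec \<Rightarrow> real" where
  "vnorm v = sqrt (\<Sum>i<dim_vec v. (cmod (v $ i))\<^sup>2)"

definition opnorm :: "complex mat \<Rightarrow> real" where
  "opnorm A = Sup {vnorm (A *\<^sub>v v) | v. v \<in> carrier_vec (dim_col A) \<and> vnorm v \<le> 1}"

(* largest / smallest eigenvalue of a Hermitian matrix (eigenvalues are real) *)
definition lam_max :: "complex mat \<Rightarrow> real" where
  "lam_max H = Max (Re ` {k. eigenvalue H k})"

definition lam_min :: "complex mat \<Rightarrow> real" where
  "lam_min H = Min (Re ` {k. eigenvalue H k})"

definition mat_exp :: "complex mat \<Rightarrow> complex mat" where
  "mat_exp A = Matrix.mat (dim_row A) (dim_col A)
     (\<lambda>(i,j). \<Sum>k. (A ^\<^sub>m k) $$ (i,j) / of_nat (fact k))"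

fun circ :: "nat \<Rightarrow> (nat \<Rightarrow> complex mat) \<Rightarrow> (nat \<Rightarrow> complex mat) \<Rightarrow> (nat \<Rightarrow> nat)
               \<Rightarrow> (nat \<Rightarrow> real) \<Rightarrow> nat list \<Rightarrow> complex mat" where
  "circ d V H S \<theta> [] = 1\<^sub>m d"
| "circ d V H S \<theta> (l # ls) =
     (V l * mat_exp ((- \<i> * complex_of_real (\<theta> (S l))) \<cdot>\<^sub>m H l)) * circ d V H S \<theta> ls"

(* generators and parameters are indexed from 0: l < M, q < m *)
definition U_circ :: "nat \<Rightarrow> (nat \<Rightarrow> complex mat) \<Rightarrow> (nat \<Rightarrow> complex mat) \<Rightarrow> (nat \<Rightarrow> nat)
               \<Rightarrow> nat \<Rightarrow> (nat \<Rightarrow> real) \<Rightarrow> complex mat" where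
  "U_circ n V H S M \<theta> = circ (2^n) V H S \<theta> [0..<M]"

(* L(theta) = Tr[U rho U^dagger Ob] (real since Ob Hermitian) *)
definition loss :: "nat \<Rightarrow> complex mat \<Rightarrow> complex mat \<Rightarrow> (nat \<Rightarrow> complex mat) \<Rightarrow> (nat \<Rightarrow> complex mat)
               \<Rightarrow> (nat \<Rightarrow> nat) \<Rightarrow> nat \<Rightarrow> (nat \<Rightarrow> real) \<Rightarrow> real" where
  "loss n \<rho> Ob V H S M \<theta> =
     (let U = U_circ n V H S M \<theta> in Re (mtrace (U * \<rho> * mat_adjoint U * Ob)))"

definition qc_instance :: "nat \<Rightarrow> complex mat \<Rightarrow> complex mat \<Rightarrow> (nat \<Rightarrow> complex mat) \<Rightarrow> (nat \<Rightarrow> complex mat)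
               \<Rightarrow> nat \<Rightarrow> nat \<Rightarrow> (nat \<Rightarrow> nat) \<Rightarrow> bool" where
  "qc_instance n \<rho> Ob V H M m S \<longleftrightarrow>
     density_op n \<rho> \<and> Ob \<in> carrier_mat (2^n) (2^n) \<and> hermitian Ob \<and>
     (\<forall>l<M. V l \<in> carrier_mat (2^n) (2^n) \<and> unitary (V l) \<and>
            H l \<in> carrier_mat (2^n) (2^n) \<and> hermitian (H l)) \<and>
     m \<le> M \<and> S ` {..<M} = {..<m}"

definition c_p :: "nat \<Rightarrow> complex mat \<Rightarrow> complex mat \<Rightarrow> (nat \<Rightarrow> complex mat) \<Rightarrow> (nat \<Rightarrow> complex mat)
               \<Rightarrow> (nat \<Rightarrow> nat) \<Rightarrow> nat \<Rightarrow> (nat \<Rightarrow> real) \<Rightarrow> nat \<Rightarrow> real" where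
  "c_p n \<rho> Ob V H S M \<phi> p =
     \<bar>deriv (deriv (\<lambda>t. loss n \<rho> Ob V H S M (\<phi>(p := t)))) (\<phi> p)\<bar>"

definition omega_max :: "(nat \<Rightarrow> complex mat) \<Rightarrow> (nat \<Rightarrow> nat) \<Rightarrow> nat \<Rightarrow> nat \<Rightarrow> real" where
  "omega_max H S M q = (\<Sum>l\<in>{l. l < M \<and> S l = q}. lam_max (H l) - lam_min (H l))"

(* r_patch^2 as a function of c = c_p, on = ||Ob||, wp = omega_p, s = sum_{q<>p} omega_q^2 *)
definition r_patch_sq :: "real \<Rightarrow> real \<Rightarrow> real \<Rightarrow> real \<Rightarrow> real" where
  "r_patch_sq c on wp s = 9 * c\<^sup>2 / (8 * (16 * c * on * wp\<^sup>2 * s + 32 * on\<^sup>2 * wp ^ 6))"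

definition unif_box :: "nat \<Rightarrow> (nat \<Rightarrow> real) \<Rightarrow> real \<Rightarrow> (nat \<Rightarrow> real) measure" where
  "unif_box m \<phi> r = PiM {..<m} (\<lambda>i. uniform_measure lborel {\<phi> i - r .. \<phi> i + r})"

definition variance_on :: "'a measure \<Rightarrow> ('a \<Rightarrow> real) \<Rightarrow> real" where
  "variance_on \<mu> f = (\<integral>x. (f x - (\<integral>y. f y \<partial>\<mu>))\<^sup>2 \<partial>\<mu>)"

end

theory Submission
  imports Defs
begin

text \<open>
  Let \<open>P = (\<theta>\<^sub>p - \<phi>\<^sub>p)\<^sup>2 - r\<^sup>2 / 3\<close>, the second Legendre polynomial in the \<open>p\<close>-th parameter. By the
  Cauchy-Schwarz inequality the variance of the loss \<open>L\<close> is at least \<open>E[L P]\<^sup>2 / E[P\<^sup>2]\<close>, where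
  \<open>E[P\<^sup>2] = 4 r\<^sup>4 / 45\<close>. A fourth-order Taylor expansion in \<open>\<theta>\<^sub>p\<close> shows that \<open>E[L P]\<close> is close to
  \<open>2 r\<^sup>4 / 45\<close> times the mean of \<open>\<partial>\<^sub>p\<^sup>2 L\<close> over the other parameters, and moving these to \<open>\<phi>\<close> one at a
  time, where by symmetry the first-order terms average out, replaces this mean by \<open>\<partial>\<^sub>p\<^sup>2 L(\<phi>)\<close>.

  The errors are controlled by \<open>\<bar>\<partial>\<^sub>q\<^sub>1 \<dots> \<partial>\<^sub>q\<^sub>j L\<bar> \<le> \<parallel>O\<parallel> \<omega>\<^sub>q\<^sub>1 \<dots> \<omega>\<^sub>q\<^sub>j\<close>: in the Heisenberg picture every
  derivative inserts a commutator with some \<open>H\<^sub>l\<close>, and \<open>\<parallel>[H\<^sub>l, X]\<parallel> \<le> (\<lambda>\<^sub>m\<^sub>a\<^sub>x - \<lambda>\<^sub>m\<^sub>i\<^sub>n) \<parallel>X\<parallel>\<close>.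
\<close>

section \<open>Spectral theorem and operator bounds\<close>

text \<open>Parameters may be shared, so the loss has no usable closed form in a single theta_p.
  What is used instead is a family of iterated partial derivatives that is closed under
  differentiation and bounded by a product of widths; sharing only turns each derivative into a sum
  over gates. A single test function suffices because only a lower bound is wanted. With y = theta_p
  - phi_p, P is orthogonal to 1, y and y^3, so in the cubic Taylor polynomial it sees the second
  derivative alone, whatever the gradient at phi is. Put X = on wp^2 s r^2, Y = on wp^4 r^2 and Z =
  on^2 wp^6 r^2, with on, wp and s as in \<open>r_patch_sq\<close>. After rescaling, the projection
  differs from the second derivative by at most X/2 + 5Y/8. The X part becomes the correction inside
  the square. The Y part enters through the cross term c Y, which is at most Z because c <= on wp^2,
  and so becomes the subtracted term.\<close>

lemma square_mult_carrier [simp]: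
  "A \<in> carrier_mat n n \<Longrightarrow> B \<in> carrier_mat n n \<Longrightarrow> A * B \<in> carrier_mat n n"
  by (rule mult_carrier_mat)

lemma index_mult_mat_sum:
  fixes A B :: "complex mat"
  assumes "A \<in> carrier_mat n m" "B \<in> carrier_mat m k" "i < n" "j < k"
  shows "(A * B) $$ (i,j) = (\<Sum>l<m. A $$ (i,l) * B $$ (l,j))"
  using assms by (simp add: scalar_prod_def lessThan_atLeast0)

lemma index_mult_mat_vec_sum:
  fixes A :: "complex mat"
  assumes "A \<in> carrier_mat n m" "v \<in> carrier_vec m" "i < n"
  shows "(A *\<^sub>v v) $ i = (\<Sum>l<m. A $$ (i,l) * v $ l)"
  using assms by (simp add: scalar_prod_def lessThan_atLeast0)

lemma cscalar_prod_sum: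
  fixes v w :: "complex Matrix.vec"
  assumes "v \<in> carrier_vec n" "w \<in> carrier_vec n"
  shows "v \<bullet>c w = (\<Sum>i<n. v $ i * cnj (w $ i))"
  using assms by (simp add: scalar_prod_def lessThan_atLeast0)

lemma mat_adjoint_carrier [simp]: "A \<in> carrier_mat n m \<Longrightarrow> mat_adjoint A \<in> carrier_mat m n"
  unfolding mat_adjoint_def by auto

lemma mat_adjoint_dim [simp]:
  "dim_row (mat_adjoint A) = dim_col A" "dim_col (mat_adjoint A) = dim_row A"
  unfolding mat_adjoint_def by auto

lemma index_mat_adjoint:
  fixes A :: "complex mat"
  assumes "i < dim_col A" "j < dim_row A"
  shows "mat_adjoint A $$ (i,j) = cnj (A $$ (j,i))"
  using assms unfolding mat_adjoint_def by (simp add: mat_of_rows_index)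

lemma mat_adjoint_mult:
  fixes A B :: "complex mat"
  assumes "A \<in> carrier_mat n m" "B \<in> carrier_mat m k"
  shows "mat_adjoint (A * B) = mat_adjoint B * mat_adjoint A"
proof (rule eq_matI)
  fix i j assume "i < dim_row (mat_adjoint B * mat_adjoint A)" "j < dim_col (mat_adjoint B * mat_adjoint A)"
  with assms have ij: "i < k" "j < n" by auto
  have "(mat_adjoint B * mat_adjoint A) $$ (i,j) = (\<Sum>l<m. mat_adjoint B $$ (i,l) * mat_adjoint A $$ (l,j))"
    using assms ij by (intro index_mult_mat_sum[of _ k m _ n]) auto
  also have "\<dots> = cnj ((A * B) $$ (j,i))"
    using assms ij by (auto simp: index_mult_mat_sum[of A n m B k] index_mat_adjoint mult.commute
        simp del: index_mult_mat intro!: sum.cong)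
  finally show "mat_adjoint (A * B) $$ (i,j) = (mat_adjoint B * mat_adjoint A) $$ (i,j)"
    using assms ij by (simp add: index_mat_adjoint del: index_mult_mat(1))
qed (use assms in auto)

lemma mat_adjoint_adjoint [simp]: "mat_adjoint (mat_adjoint A) = (A :: complex mat)"
  by (rule eq_matI) (auto simp: index_mat_adjoint)

lemma mat_adjoint_one: "mat_adjoint (1\<^sub>m n :: complex mat) = 1\<^sub>m n"
  by (rule eq_matI) (auto simp: index_mat_adjoint)

lemma cscalar_prod_adjoint:
  fixes A :: "complex mat"
  assumes A: "A \<in> carrier_mat n m" and v: "v \<in> carrier_vec m" and w: "w \<in> carrier_vec n"
  shows "(A *\<^sub>v v) \<bullet>c w = v \<bullet>c (mat_adjoint A *\<^sub>v w)"
proof -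
  have "(A *\<^sub>v v) \<bullet>c w = (\<Sum>i<n. \<Sum>l<m. A $$ (i,l) * v $ l * cnj (w $ i))"
    using A v w by (subst cscalar_prod_sum[of _ n])
      (auto simp: index_mult_mat_vec_sum[of A n m] sum_distrib_right simp del: index_mult_mat_vec)
  also have "\<dots> = (\<Sum>l<m. \<Sum>i<n. A $$ (i,l) * v $ l * cnj (w $ i))"
    by (rule sum.swap)
  also have "\<dots> = v \<bullet>c (mat_adjoint A *\<^sub>v w)"
    using A v w mult_mat_vec_carrier[of "mat_adjoint A" m n w] by (subst cscalar_prod_sum[of _ m])
      (auto simp: index_mult_mat_vec_sum[of "mat_adjoint A" m n] sum_distrib_left index_mat_adjoint
        mult_ac simp del: index_mult_mat_vec intro!: sum.cong)
  finally show ?thesis .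
qed

lemma mtrace_mult_commute:
  assumes A: "A \<in> carrier_mat n m" and B: "B \<in> carrier_mat m n"
  shows "mtrace (A * B) = mtrace (B * A)"
proof -
  have "mtrace (A * B) = (\<Sum>i<n. \<Sum>l<m. A $$ (i,l) * B $$ (l,i))"
    using A B unfolding mtrace_def
    by (auto simp: index_mult_mat_sum[of A n m B n] simp del: index_mult_mat(1) intro!: sum.cong)
  also have "\<dots> = (\<Sum>l<m. \<Sum>i<n. A $$ (i,l) * B $$ (l,i))"
    by (rule sum.swap)
  also have "\<dots> = mtrace (B * A)"
    using A B unfolding mtrace_def
    by (auto simp: index_mult_mat_sum[of B m n A m] mult.commute simp del: index_mult_mat(1) intro!: sum.cong)
  finally show ?thesis .
qed

text \<open>By the Schur form the trace is the sum of the n eigenvalues with multiplicity; were they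
  all c, it would be n c. This allows a deflation argument that never restricts a matrix to a
  subspace.\<close>

lemma exists_eigenvalue_neq:
  fixes A :: "complex mat"
  assumes A: "A \<in> carrier_mat n n" and tr: "mtrace A \<noteq> of_nat n * c"
  shows "\<exists>e. e \<noteq> c \<and> eigenvalue A e"
proof -
  obtain es where es: "char_poly A = (\<Prod>a\<leftarrow>es. [:- a, 1:])" "length es = n"
    using char_poly_factorized[OF A] by blast
  obtain B P Q where BPQ: "schur_decomposition A es = (B,P,Q)"
    by (cases "schur_decomposition A es")
  have w: "similar_mat_wit A B P Q" and diag: "diag_mat B = es"
    using schur_decomposition[OF A es(1) BPQ] by auto
  note s = similar_mat_witD2[OF A w]
  have "mtrace A = mtrace (P * (B * Q))"
    using s by (simp add: assoc_mult_mat[of P n n B n Q n])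
  also have "\<dots> = mtrace (B * Q * P)"
    using s by (intro mtrace_mult_commute[of _ n n]) auto
  also have "B * Q * P = B"
    using s by (simp add: assoc_mult_mat[of B n n Q n P n])
  also have "mtrace B = sum_list es"
    using s unfolding diag[symmetric] mtrace_def diag_mat_def
    by (simp add: sum_list_distinct_conv_sum_set lessThan_atLeast0)
  finally have "sum_list es \<noteq> of_nat (length es) * c"
    using tr es by simp
  then have "\<exists>e \<in> set es. e \<noteq> c"
    by (induction es) (auto simp: algebra_simps)
  then obtain e where e: "e \<in> set es" "e \<noteq> c" by blast
  have "poly (char_poly A) e = 0"
    using e(1) unfolding es(1) by (induction es) auto
  then show ?thesis
    using e eigenvalue_root_char_poly[OF A] by auto
qed

lemma cscalar_prod_self:
  fixes v :: "complex Matrix.vec"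
  shows "v \<bullet>c v = complex_of_real ((vnorm v)\<^sup>2)"
proof -
  have "v \<bullet>c v = (\<Sum>i<dim_vec v. v $ i * cnj (v $ i))"
    by (rule cscalar_prod_sum) auto
  also have "\<dots> = complex_of_real ((vnorm v)\<^sup>2)"
    unfolding vnorm_def by (simp add: sum_nonneg complex_norm_square[symmetric])
  finally show ?thesis .
qed

lemma vnorm_eq_0:
  assumes "v \<in> carrier_vec n"
  shows "vnorm v = 0 \<longleftrightarrow> v = 0\<^sub>v n"
  using assms unfolding vnorm_def
  by (auto simp: sum_nonneg_eq_0_iff)

lemma hermitian_eigenvalue_real:
  fixes A :: "complex mat"
  assumes A: "A \<in> carrier_mat n n" and h: "mat_adjoint A = A" and u: "u \<in> carrier_vec n"
    and ev: "A *\<^sub>v u = \<mu> \<cdot>\<^sub>v u" and nz: "u \<bullet>c u \<noteq> 0"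
  shows "cnj \<mu> = \<mu>"
proof -
  have "\<mu> * (u \<bullet>c u) = (A *\<^sub>v u) \<bullet>c u" using u ev by simp
  also have "\<dots> = u \<bullet>c (A *\<^sub>v u)"
    using cscalar_prod_adjoint[OF A u u] h by simp
  also have "\<dots> = cnj \<mu> * (u \<bullet>c u)" using u ev by (simp add: conjugate_smult_vec)
  finally show ?thesis using nz by simp
qed

text \<open>Given orthonormal eigenvectors \<open>u\<^sub>0, \<dots>, u\<^sub>k\<^sub>-\<^sub>1\<close>, replacing their eigenvalues by a common
  real value \<open>c\<close> whose \<open>n\<close>-fold is not the trace produces an eigenvalue other than \<open>c\<close>; its
  eigenvectors are orthogonal to all \<open>u\<^sub>i\<close>.\<close>

lemma hermitian_orthonormal_eigenvectors:
  assumes A: "A \<in> carrier_mat n n" and h: "mat_adjoint A = A" and "k \<le> n"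
  shows "\<exists>(u :: nat \<Rightarrow> complex Matrix.vec) (\<mu> :: nat \<Rightarrow> complex). \<forall>i<k. u i \<in> carrier_vec n \<and> A *\<^sub>v u i = \<mu> i \<cdot>\<^sub>v u i \<and>
           (\<forall>j<k. u i \<bullet>c u j = (if i = j then 1 else 0))"
  using \<open>k \<le> n\<close>
proof (induction k)
  case (Suc k)
  then obtain u \<mu> where u: "\<And>i. i < k \<Longrightarrow> u i \<in> carrier_vec n"
    and ev: "\<And>i. i < k \<Longrightarrow> A *\<^sub>v u i = \<mu> i \<cdot>\<^sub>v u i"
    and on: "\<And>i j. i < k \<Longrightarrow> j < k \<Longrightarrow> u i \<bullet>c u j = (if i = j then 1 else 0)"
    by (metis Suc_leD)
  have real: "cnj (\<mu> i) = \<mu> i" if i: "i < k" for i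
    using hermitian_eigenvalue_real[OF A h u[OF i] ev[OF i]] on[OF i i] by simp
  define t where "t = mtrace A - (\<Sum>l<k. \<mu> l)"
  \<comment> \<open>The value to avoid satisfies t = (n - k) c with n - k > 0: if t = 0 then c = 1
    violates it, otherwise c = 0 does. Both choices are real, which keeps \<open>B\<close>
    Hermitian.\<close>
  define c where "c = (if t = 0 then 1 else 0::complex)"
  have tc: "t + of_nat k * c \<noteq> of_nat n * c"
    using Suc.prems by (auto simp: c_def)
  have creal: "cnj c = c" by (simp add: c_def)
  define B where "B = Matrix.mat n n (\<lambda>(i,j). A $$ (i,j) + (\<Sum>l<k. (c - \<mu> l) * (u l $ i * cnj (u l $ j))))"
  have B: "B \<in> carrier_mat n n" by (simp add: B_def)
  have norm1: "(\<Sum>i<n. u l $ i * cnj (u l $ i)) = 1" if "l < k" for l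
    using on[OF that that] cscalar_prod_sum[OF u[OF that] u[OF that]] by simp
  have "mtrace B = mtrace A + (\<Sum>i<n. \<Sum>l<k. (c - \<mu> l) * (u l $ i * cnj (u l $ i)))"
    using A unfolding mtrace_def by (simp add: B_def sum.distrib)
  also have "(\<Sum>i<n. \<Sum>l<k. (c - \<mu> l) * (u l $ i * cnj (u l $ i))) = (\<Sum>l<k. c - \<mu> l)"
    by (subst sum.swap) (simp add: sum_distrib_left[symmetric] norm1)
  also have "mtrace A + \<dots> = t + of_nat k * c"
    by (simp add: t_def sum_subtractf)
  finally have "mtrace B \<noteq> of_nat n * c" using tc by simp
  then obtain e where e: "e \<noteq> c" "eigenvalue B e"
    using exists_eigenvalue_neq[OF B] by blast
  then obtain v where v: "v \<in> carrier_vec n" "v \<noteq> 0\<^sub>v n" "B *\<^sub>v v = e \<cdot>\<^sub>v v"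
    using B unfolding eigenvalue_def eigenvector_def by auto
  have Bw: "(B *\<^sub>v w) $ i = (A *\<^sub>v w) $ i + (\<Sum>l<k. (c - \<mu> l) * (w \<bullet>c u l) * u l $ i)"
    if w: "w \<in> carrier_vec n" and i: "i < n" for w i
  proof -
    have "(B *\<^sub>v w) $ i = (A *\<^sub>v w) $ i + (\<Sum>j<n. \<Sum>l<k. (c - \<mu> l) * (u l $ i * cnj (u l $ j)) * w $ j)"
      unfolding index_mult_mat_vec_sum[OF B w i] index_mult_mat_vec_sum[OF A w i]
      using i by (simp add: B_def sum.distrib sum_distrib_right distrib_right)
    also have "(\<Sum>j<n. \<Sum>l<k. (c - \<mu> l) * (u l $ i * cnj (u l $ j)) * w $ j)
       = (\<Sum>l<k. \<Sum>j<n. (c - \<mu> l) * (u l $ i * cnj (u l $ j)) * w $ j)"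
      by (rule sum.swap)
    also have "\<dots> = (\<Sum>l<k. (c - \<mu> l) * (w \<bullet>c u l) * u l $ i)"
      using w u by (auto simp: cscalar_prod_sum[of w n] sum_distrib_left sum_distrib_right mult_ac intro!: sum.cong)
    finally show ?thesis .
  qed
  have hB: "mat_adjoint B = B"
  proof (rule eq_matI)
    fix i j assume "i < dim_row B" "j < dim_col B"
    then have ij: "i < n" "j < n" using B by auto
    have "cnj (A $$ (j,i)) = A $$ (i,j)"
      using index_mat_adjoint[of i A j] h A ij by simp
    then show "mat_adjoint B $$ (i,j) = B $$ (i,j)"
      using ij B by (simp add: index_mat_adjoint) (simp add: B_def creal real mult_ac)
  qed (use B in auto)
  have Bu: "B *\<^sub>v u i = c \<cdot>\<^sub>v u i" if i: "i < k" for i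
  proof (rule eq_vecI)
    fix j assume "j < dim_vec (c \<cdot>\<^sub>v u i)"
    then have j: "j < n" using u[OF i] by auto
    have "(\<Sum>l<k. (c - \<mu> l) * (u i \<bullet>c u l) * u l $ j) = (\<Sum>l<k. if l = i then (c - \<mu> l) * u l $ j else 0)"
      using i by (intro sum.cong) (auto simp: on)
    also have "\<dots> = (c - \<mu> i) * u i $ j" using i by simp
    finally show "(B *\<^sub>v u i) $ j = (c \<cdot>\<^sub>v u i) $ j"
      using Bw[OF u[OF i] j] ev[OF i] u[OF i] j
      by (simp add: algebra_simps del: index_mult_mat_vec)
  qed (use B u[OF i] in auto)
  \<comment> \<open>\<open>v\<close> and \<open>u i\<close> belong to the different eigenvalues e
    and c of the Hermitian matrix \<open>B\<close>. Orthogonality then makes the rank-one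
    corrections vanish on \<open>v\<close>, so that \<open>v\<close> is an eigenvector of
    \<open>A\<close> itself.\<close>
  have orth: "v \<bullet>c u i = 0" if i: "i < k" for i
  proof -
    have "e * (v \<bullet>c u i) = (B *\<^sub>v v) \<bullet>c u i" using v u[OF i] by simp
    also have "\<dots> = v \<bullet>c (B *\<^sub>v u i)"
      using cscalar_prod_adjoint[OF B v(1) u[OF i]] hB by simp
    also have "\<dots> = c * (v \<bullet>c u i)"
      using v u[OF i] by (simp add: Bu[OF i] conjugate_smult_vec creal)
    finally show ?thesis using e(1) by simp
  qed
  have Av: "A *\<^sub>v v = e \<cdot>\<^sub>v v"
  proof (rule eq_vecI)
    fix j assume "j < dim_vec (e \<cdot>\<^sub>v v)"
    then have j: "j < n" using v by auto
    show "(A *\<^sub>v v) $ j = (e \<cdot>\<^sub>v v) $ j"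
      using Bw[OF v(1) j] orth v by (simp del: index_mult_mat_vec)
  qed (use A v in auto)
  define a where "a = complex_of_real (1 / vnorm v)"
  define w where "w = a \<cdot>\<^sub>v v"
  have nz: "vnorm v \<noteq> 0" using v vnorm_eq_0 by blast
  have w: "w \<in> carrier_vec n" using v by (simp add: w_def)
  have orth': "u i \<bullet>c v = 0" if i: "i < k" for i
  proof -
    have "u i \<bullet>c v = conjugate (v \<bullet>c u i)"
      using conjugate_conjugate_sprod[OF u[OF i] v(1)] by (metis conjugate_vec_sprod_comm u[OF i] v(1) conjugate_id conjugate_conjugate_sprod)
    then show ?thesis using orth[OF i] by simp
  qed
  have ww: "w \<bullet>c w = 1"
    using v nz by (simp add: w_def a_def conjugate_smult_vec cscalar_prod_self power2_eq_square)
  have wu: "w \<bullet>c u i = 0" "u i \<bullet>c w = 0" if i: "i < k" for i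
    using v u[OF i] orth[OF i] orth'[OF i] by (simp_all add: w_def conjugate_smult_vec)
  have Aw: "A *\<^sub>v w = e \<cdot>\<^sub>v w"
    using A v Av by (simp add: w_def mult_mat_vec smult_smult_assoc mult.commute)
  show ?case
    apply (intro exI[of _ "u(k := w)"] exI[of _ "\<mu>(k := e)"])
    using u ev on w ww wu Aw by (auto simp: less_Suc_eq)
qed simp


section \<open>Diagonal matrices and unitary diagonalisation\<close>

definition diag_of :: "nat \<Rightarrow> (nat \<Rightarrow> complex) \<Rightarrow> complex mat" where
  "diag_of n f = Matrix.mat n n (\<lambda>(i,j). if i = j then f i else 0)"

lemma diag_of_carrier [simp]: "diag_of n f \<in> carrier_mat n n"
  by (simp add: diag_of_def)

lemma index_diag_of: "i < n \<Longrightarrow> j < n \<Longrightarrow> diag_of n f $$ (i,j) = (if i = j then f i else 0)"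
  by (simp add: diag_of_def)

lemma index_mult_diag_of:
  assumes "A \<in> carrier_mat m n" "i < m" "j < n"
  shows "(A * diag_of n f) $$ (i,j) = A $$ (i,j) * f j"
proof -
  have "(A * diag_of n f) $$ (i,j) = (\<Sum>l<n. A $$ (i,l) * diag_of n f $$ (l,j))"
    using assms by (intro index_mult_mat_sum) auto
  also have "\<dots> = (\<Sum>l<n. if l = j then A $$ (i,l) * f j else 0)"
    using assms by (intro sum.cong) (auto simp: index_diag_of)
  finally show ?thesis using assms by simp
qed

lemma diag_of_mult: "diag_of n f * diag_of n g = diag_of n (\<lambda>i. f i * g i)"
  by (rule eq_matI)
    (auto simp: index_mult_diag_of[of _ n] index_diag_of carrier_matD[OF diag_of_carrier] simp del: index_mult_mat(1))

lemma diag_of_mult_vec: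
  assumes "v \<in> carrier_vec n" "i < n"
  shows "(diag_of n f *\<^sub>v v) $ i = f i * v $ i"
proof -
  have "(diag_of n f *\<^sub>v v) $ i = (\<Sum>l<n. diag_of n f $$ (i,l) * v $ l)"
    using assms by (intro index_mult_mat_vec_sum) auto
  also have "\<dots> = (\<Sum>l<n. if l = i then f l * v $ l else 0)"
    using assms by (intro sum.cong) (auto simp: index_diag_of)
  finally show ?thesis using assms by simp
qed

text \<open>The last two conclusions identify the entries d i as eigenvalues with unit eigenvectors.
  They are what connects d to \<open>lam_min\<close> and \<open>lam_max\<close>, and to positivity
  when \<open>A\<close> is a density operator.\<close>

theorem hermitian_spectral_decomposition:
  assumes A: "A \<in> carrier_mat n n" and h: "mat_adjoint A = A"
  obtains W d where "W \<in> carrier_mat n n" "mat_adjoint W * W = 1\<^sub>m n" "W * mat_adjoint W = 1\<^sub>m n"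
    "A = W * diag_of n (\<lambda>i. complex_of_real (d i)) * mat_adjoint W"
    "\<And>i. i < n \<Longrightarrow> A *\<^sub>v col W i = complex_of_real (d i) \<cdot>\<^sub>v col W i"
    "\<And>i. i < n \<Longrightarrow> col W i \<bullet>c col W i = 1"
proof -
  obtain u \<mu> where u: "\<And>i. i < n \<Longrightarrow> u i \<in> carrier_vec n"
    and ev: "\<And>i. i < n \<Longrightarrow> A *\<^sub>v u i = \<mu> i \<cdot>\<^sub>v u i"
    and on: "\<And>i j. i < n \<Longrightarrow> j < n \<Longrightarrow> u i \<bullet>c u j = (if i = j then 1 else 0)"
    using hermitian_orthonormal_eigenvectors[OF A h order_refl] by metis
  have real: "\<mu> i = complex_of_real (Re (\<mu> i))" if i: "i < n" for i
    using hermitian_eigenvalue_real[OF A h u[OF i] ev[OF i]] on[OF i i]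
    by (simp add: complex_eq_iff)
  define W where "W = Matrix.mat n n (\<lambda>(i,j). u j $ i)"
  have W: "W \<in> carrier_mat n n" by (simp add: W_def)
  have cW: "col W j = u j" if "j < n" for j
    using that u[OF that] by (intro eq_vecI) (auto simp: W_def)
  have WW: "mat_adjoint W * W = 1\<^sub>m n"
  proof (rule eq_matI)
    fix i j assume "i < dim_row (1\<^sub>m n :: complex mat)" "j < dim_col (1\<^sub>m n :: complex mat)"
    then have ij: "i < n" "j < n" by auto
    have "(mat_adjoint W * W) $$ (i,j) = (\<Sum>l<n. mat_adjoint W $$ (i,l) * W $$ (l,j))"
      using W ij by (intro index_mult_mat_sum[of _ n n _ n]) auto
    also have "\<dots> = u j \<bullet>c u i"
      using W ij u by (auto simp: cscalar_prod_sum[of _ n] index_mat_adjoint W_def mult.commute intro!: sum.cong)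
    finally show "(mat_adjoint W * W) $$ (i,j) = 1\<^sub>m n $$ (i,j)"
      using ij by (simp add: on del: index_mult_mat)
  qed (use W in auto)
  have WW': "W * mat_adjoint W = 1\<^sub>m n"
    using mat_mult_left_right_inverse[OF _ W WW] W by simp
  let ?D = "diag_of n (\<lambda>i. complex_of_real (Re (\<mu> i)))"
  have AW: "A * W = W * ?D"
  proof (rule eq_matI)
    fix i j assume "i < dim_row (W * ?D)" "j < dim_col (W * ?D)"
    then have ij: "i < n" "j < n" using W carrier_matD[OF diag_of_carrier] by auto
    have "(A * W) $$ (i,j) = (A *\<^sub>v col W j) $ i"
      using A W ij by simp
    also have "\<dots> = \<mu> j * u j $ i" using ij u[of j] by (simp add: cW ev del: index_mult_mat_vec)
    also have "\<dots> = (W * ?D) $$ (i,j)"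
      unfolding index_mult_diag_of[OF W ij] using ij real[of j] by (simp add: W_def)
    finally show "(A * W) $$ (i,j) = (W * ?D) $$ (i,j)" .
  qed (use A W carrier_matD[OF diag_of_carrier] in auto)
  have "A = A * (W * mat_adjoint W)" using A by (simp add: WW')
  also have "\<dots> = W * ?D * mat_adjoint W"
    using A W by (simp add: assoc_mult_mat[symmetric, of A n n W n _ n] AW)
  finally show ?thesis
    using that[of W "\<lambda>i. Re (\<mu> i)"] W WW WW' ev on real cW by auto
qed

section \<open>Operator norm bounds\<close>

text \<open>Norm bounds are kept as a predicate so that they pass through products and differences
  without any supremum; \<open>opnorm\<close> supplies the initial bound through
  \<open>op_bounded_by_opnorm\<close>.\<close>

definition op_bounded_by :: "complex mat \<Rightarrow> real \<Rightarrow> bool" where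
  "op_bounded_by A b \<longleftrightarrow> (\<forall>v\<in>carrier_vec (dim_col A). vnorm (A *\<^sub>v v) \<le> b * vnorm v)"

lemma vnorm_L2_set: "vnorm v = L2_set (\<lambda>i. cmod (v $ i)) {..<dim_vec v}"
  by (simp add: vnorm_def L2_set_def)

lemma vnorm_nonneg [simp]: "0 \<le> vnorm v"
  by (simp add: vnorm_def sum_nonneg)

lemma vnorm_minus:
  assumes "v \<in> carrier_vec n" "w \<in> carrier_vec n"
  shows "vnorm (v - w) \<le> vnorm v + vnorm w"
proof -
  have "vnorm (v - w) \<le> L2_set (\<lambda>i. cmod (v $ i) + cmod (w $ i)) {..<n}"
    using assms unfolding vnorm_L2_set by (auto intro!: L2_set_mono norm_triangle_ineq4)
  also have "\<dots> \<le> vnorm v + vnorm w"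
    using assms unfolding vnorm_L2_set by (auto intro!: L2_set_triangle_ineq)
  finally show ?thesis .
qed

lemma vnorm_smult: "vnorm (c \<cdot>\<^sub>v v) = cmod c * vnorm v"
  by (simp add: vnorm_def norm_mult power_mult_distrib sum_distrib_left[symmetric] real_sqrt_mult)

lemma op_bounded_by_mult:
  assumes "A \<in> carrier_mat n m" "B \<in> carrier_mat m k" "op_bounded_by A a" "op_bounded_by B b" "0 \<le> a"
  shows "op_bounded_by (A * B) (a * b)"
  unfolding op_bounded_by_def
proof
  fix v :: "complex Matrix.vec" assume "v \<in> carrier_vec (dim_col (A * B))"
  then have v: "v \<in> carrier_vec k" using assms by simp
  then have Bv: "B *\<^sub>v v \<in> carrier_vec m" using assms by simp
  have "vnorm (A * B *\<^sub>v v) = vnorm (A *\<^sub>v (B *\<^sub>v v))"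
    using assms v by (simp add: assoc_mult_mat_vec)
  also have "\<dots> \<le> a * vnorm (B *\<^sub>v v)"
    using assms Bv unfolding op_bounded_by_def by auto
  also have "\<dots> \<le> a * (b * vnorm v)"
    using assms v unfolding op_bounded_by_def by (intro mult_left_mono) auto
  finally show "vnorm (A * B *\<^sub>v v) \<le> a * b * vnorm v" by simp
qed

lemma op_bounded_by_minus:
  assumes "A \<in> carrier_mat n m" "B \<in> carrier_mat n m" "op_bounded_by A a" "op_bounded_by B b"
  shows "op_bounded_by (A - B) (a + b)"
  unfolding op_bounded_by_def
proof
  fix v :: "complex Matrix.vec" assume "v \<in> carrier_vec (dim_col (A - B))"
  then have v: "v \<in> carrier_vec m" using assms by simp
  have "vnorm ((A - B) *\<^sub>v v) \<le> vnorm (A *\<^sub>v v) + vnorm (B *\<^sub>v v)"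
    using assms v by (simp add: minus_mult_distrib_mat_vec vnorm_minus[of _ n])
  also have "\<dots> \<le> a * vnorm v + b * vnorm v"
    using assms v unfolding op_bounded_by_def by (intro add_mono) auto
  finally show "vnorm ((A - B) *\<^sub>v v) \<le> (a + b) * vnorm v" by (simp add: algebra_simps)
qed

lemma op_bounded_by_smult:
  assumes "op_bounded_by A a"
  shows "op_bounded_by (c \<cdot>\<^sub>m A) (cmod c * a)"
  unfolding op_bounded_by_def
proof
  fix v :: "complex Matrix.vec" assume v: "v \<in> carrier_vec (dim_col (c \<cdot>\<^sub>m A))"
  have "(c \<cdot>\<^sub>m A) *\<^sub>v v = c \<cdot>\<^sub>v (A *\<^sub>v v)"
    using v by (intro eq_vecI) auto
  then show "vnorm ((c \<cdot>\<^sub>m A) *\<^sub>v v) \<le> cmod c * a * vnorm v"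
    using assms v unfolding op_bounded_by_def by (simp add: vnorm_smult mult_left_mono mult.assoc)
qed

lemma op_bounded_by_isometry:
  assumes W: "W \<in> carrier_mat n n" and WW: "mat_adjoint W * W = 1\<^sub>m n"
  shows "op_bounded_by W 1"
  unfolding op_bounded_by_def
proof
  fix v :: "complex Matrix.vec" assume "v \<in> carrier_vec (dim_col W)"
  then have v: "v \<in> carrier_vec n" using W by simp
  have "(W *\<^sub>v v) \<bullet>c (W *\<^sub>v v) = v \<bullet>c (mat_adjoint W *\<^sub>v (W *\<^sub>v v))"
    using W v by (intro cscalar_prod_adjoint) auto
  also have "mat_adjoint W *\<^sub>v (W *\<^sub>v v) = v"
    using W v WW by (simp add: assoc_mult_mat_vec[symmetric, of _ n n])
  finally have "(vnorm (W *\<^sub>v v))\<^sup>2 = (vnorm v)\<^sup>2"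
    unfolding cscalar_prod_self of_real_eq_iff .
  then show "vnorm (W *\<^sub>v v) \<le> 1 * vnorm v"
    by (simp add: power2_eq_iff_nonneg)
qed

lemma op_bounded_by_diag_of:
  assumes "\<And>i. i < n \<Longrightarrow> cmod (f i) \<le> b" "0 \<le> b"
  shows "op_bounded_by (diag_of n f) b"
  unfolding op_bounded_by_def
proof
  fix v :: "complex Matrix.vec" assume "v \<in> carrier_vec (dim_col (diag_of n f))"
  then have v: "v \<in> carrier_vec n" using carrier_matD[OF diag_of_carrier] by simp
  have "vnorm (diag_of n f *\<^sub>v v) \<le> L2_set (\<lambda>i. b * cmod (v $ i)) {..<n}"
    unfolding vnorm_L2_set using assms v carrier_matD[OF diag_of_carrier]
    by (auto simp: diag_of_mult_vec norm_mult mult_right_mono simp del: index_mult_mat_vec intro!: L2_set_mono)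
  also have "\<dots> = b * vnorm v"
    using assms v by (simp add: vnorm_L2_set L2_set_right_distrib)
  finally show "vnorm (diag_of n f *\<^sub>v v) \<le> b * vnorm v" .
qed

lemma vnorm_unit_vec: "i < n \<Longrightarrow> vnorm (unit_vec n i) = 1"
  by (simp add: vnorm_def if_distrib[of cmod] if_distrib[of "\<lambda>x. x\<^sup>2"] cong: if_cong)

lemma op_bounded_by_entry:
  assumes A: "A \<in> carrier_mat n n" and "op_bounded_by A b" and i: "i < n" and j: "j < n"
  shows "cmod (A $$ (i,j)) \<le> b"
proof -
  have "(A *\<^sub>v unit_vec n j) $ i = (\<Sum>l<n. A $$ (i,l) * (unit_vec n j) $ l)"
    using A i by (intro index_mult_mat_vec_sum) auto
  also have "\<dots> = (\<Sum>l<n. if l = j then A $$ (i,l) else 0)"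
    using j by (intro sum.cong) auto
  finally have "cmod (A $$ (i,j)) = cmod ((A *\<^sub>v unit_vec n j) $ i)"
    using j by simp
  also have "\<dots> \<le> vnorm (A *\<^sub>v unit_vec n j)"
    using A i unfolding vnorm_L2_set by (intro member_le_L2_set) auto
  also have "\<dots> \<le> b * vnorm (unit_vec n j)"
    using assms unfolding op_bounded_by_def by auto
  finally show ?thesis using j by (simp add: vnorm_unit_vec)
qed

text \<open>The constant is crude; what counts is its existence, which makes the set in the
  definition of \<open>opnorm\<close> bounded above and its supremum meaningful.\<close>

lemma op_bounded_by_exists:
  assumes A: "A \<in> carrier_mat n m"
  shows "\<exists>K\<ge>0. op_bounded_by A K"
proof -
  define K where "K = (\<Sum>i<n. \<Sum>j<m. cmod (A $$ (i,j)))"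
  have "op_bounded_by A K"
    unfolding op_bounded_by_def
  proof
    fix v :: "complex Matrix.vec" assume "v \<in> carrier_vec (dim_col A)"
    then have v: "v \<in> carrier_vec m" using A by simp
    have "vnorm (A *\<^sub>v v) \<le> (\<Sum>i<n. cmod ((A *\<^sub>v v) $ i))"
      using A unfolding vnorm_L2_set by (auto simp del: index_mult_mat_vec intro!: L2_set_le_sum)
    also have "\<dots> \<le> (\<Sum>i<n. \<Sum>j<m. cmod (A $$ (i,j)) * vnorm v)"
    proof (intro sum_mono)
      fix i assume "i \<in> {..<n}"
      then have "cmod ((A *\<^sub>v v) $ i) \<le> (\<Sum>j<m. cmod (A $$ (i,j) * v $ j))"
        using A v by (simp add: index_mult_mat_vec_sum[of A n m] norm_sum del: index_mult_mat_vec)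
      also have "\<dots> \<le> (\<Sum>j<m. cmod (A $$ (i,j)) * vnorm v)"
        using v unfolding vnorm_L2_set norm_mult
        by (intro sum_mono mult_left_mono member_le_L2_set) auto
      finally show "cmod ((A *\<^sub>v v) $ i) \<le> (\<Sum>j<m. cmod (A $$ (i,j)) * vnorm v)" .
    qed
    finally show "vnorm (A *\<^sub>v v) \<le> K * vnorm v" by (simp add: K_def sum_distrib_right)
  qed
  moreover have "K \<ge> 0" by (simp add: K_def sum_nonneg)
  ultimately show ?thesis by blast
qed

lemma vnorm_mult_le_opnorm:
  assumes A: "A \<in> carrier_mat n m" and v: "v \<in> carrier_vec m" "vnorm v \<le> 1"
  shows "vnorm (A *\<^sub>v v) \<le> opnorm A"
  unfolding opnorm_def
proof (rule cSup_upper)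
  obtain K where K: "K \<ge> 0" "op_bounded_by A K" using op_bounded_by_exists[OF A] by blast
  show "bdd_above {vnorm (A *\<^sub>v v) |v. v \<in> carrier_vec (dim_col A) \<and> vnorm v \<le> 1}"
  proof (rule bdd_aboveI[of _ K])
    fix x assume "x \<in> {vnorm (A *\<^sub>v v) |v. v \<in> carrier_vec (dim_col A) \<and> vnorm v \<le> 1}"
    then obtain v where v: "v \<in> carrier_vec (dim_col A)" "vnorm v \<le> 1" "x = vnorm (A *\<^sub>v v)" by blast
    have "x \<le> K * vnorm v" using K v unfolding op_bounded_by_def by auto
    also have "\<dots> \<le> K" using K v by (simp add: mult_left_le)
    finally show "x \<le> K" .
  qed
qed (use assms in auto)

lemma opnorm_nonneg:
  assumes A: "A \<in> carrier_mat n m"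
  shows "0 \<le> opnorm A"
proof -
  have "vnorm (A *\<^sub>v 0\<^sub>v m) \<le> opnorm A"
    by (rule vnorm_mult_le_opnorm[OF A]) (auto simp: vnorm_def)
  then show ?thesis using vnorm_nonneg order_trans by blast
qed

lemma op_bounded_by_opnorm:
  assumes A: "A \<in> carrier_mat n m"
  shows "op_bounded_by A (opnorm A)"
  unfolding op_bounded_by_def
proof
  fix v :: "complex Matrix.vec" assume "v \<in> carrier_vec (dim_col A)"
  then have v: "v \<in> carrier_vec m" using A by simp
  show "vnorm (A *\<^sub>v v) \<le> opnorm A * vnorm v"
  proof (cases "vnorm v = 0")
    case True
    then show ?thesis using op_bounded_by_exists[OF A] v A unfolding op_bounded_by_def by auto
  next
    case False
    then have pos: "vnorm v > 0" using vnorm_nonneg[of v] by linarith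
    define w where "w = complex_of_real (1 / vnorm v) \<cdot>\<^sub>v v"
    have w: "w \<in> carrier_vec m" "vnorm w \<le> 1"
      using v pos by (auto simp: w_def vnorm_smult norm_divide)
    have "vnorm (A *\<^sub>v w) = vnorm (A *\<^sub>v v) / vnorm v"
      using A v pos by (simp add: w_def mult_mat_vec vnorm_smult norm_divide)
    then show ?thesis
      using vnorm_mult_le_opnorm[OF A w] pos by (simp add: divide_le_eq)
  qed
qed

lemma eigenvalue_le_opnorm:
  assumes A: "A \<in> carrier_mat n n" and "eigenvalue A k"
  shows "cmod k \<le> opnorm A"
proof -
  obtain v where v: "v \<in> carrier_vec n" "v \<noteq> 0\<^sub>v n" "A *\<^sub>v v = k \<cdot>\<^sub>v v"
    using assms unfolding eigenvalue_def eigenvector_def by auto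
  have "cmod k * vnorm v \<le> opnorm A * vnorm v"
    using op_bounded_by_opnorm[OF A] v A unfolding op_bounded_by_def by (auto simp: vnorm_smult)
  moreover have "vnorm v > 0" using vnorm_eq_0[OF v(1)] v(2) vnorm_nonneg[of v] by linarith
  ultimately show ?thesis by simp
qed

lemma finite_eigenvalues:
  fixes A :: "complex mat"
  assumes A: "A \<in> carrier_mat n n"
  shows "finite {k. eigenvalue A k}"
proof -
  have "char_poly A \<noteq> 0" using degree_monic_char_poly[OF A] by auto
  then show ?thesis
    using poly_roots_finite eigenvalue_root_char_poly[OF A] by simp
qed

lemma exists_eigenvalue:
  fixes A :: "complex mat"
  assumes A: "A \<in> carrier_mat n n" and n: "n > 0"
  shows "\<exists>k. eigenvalue A k"
  using exists_eigenvalue_neq[OF A, of "(mtrace A + 1) / of_nat n"] n by auto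

lemma lam_bounds:
  assumes A: "A \<in> carrier_mat n n" and "eigenvalue A (complex_of_real k)"
  shows "lam_min A \<le> k" "k \<le> lam_max A"
  using assms finite_eigenvalues[OF A] unfolding lam_min_def lam_max_def
  by (force intro!: Min_le Max_ge)+

lemma lam_min_le_lam_max:
  assumes A: "A \<in> carrier_mat n n" and n: "n > 0"
  shows "lam_min A \<le> lam_max A"
  using exists_eigenvalue[OF A n] finite_eigenvalues[OF A] unfolding lam_min_def lam_max_def
  by (auto intro: Min.coboundedI[THEN order_trans, OF _ _ Max_ge])

lemma lam_diff_le_opnorm:
  assumes A: "A \<in> carrier_mat n n" and n: "n > 0"
  shows "lam_max A - lam_min A \<le> 2 * opnorm A"
proof -
  let ?E = "Re ` {k. eigenvalue A k}"
  have E: "finite ?E" "?E \<noteq> {}" using exists_eigenvalue[OF A n] finite_eigenvalues[OF A] by auto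
  have le: "\<bar>x\<bar> \<le> opnorm A" if "x \<in> ?E" for x
    using that eigenvalue_le_opnorm[OF A] abs_Re_le_cmod order_trans by blast
  show ?thesis
    using le[OF Max_in[OF E]] le[OF Min_in[OF E]] unfolding lam_min_def lam_max_def by linarith
qed

section \<open>Commutators, and traces against a density operator\<close>

definition comm_i :: "complex mat \<Rightarrow> complex mat \<Rightarrow> complex mat" where
  "comm_i H X = \<i> \<cdot>\<^sub>m (H * X - X * H)"

lemma comm_i_carrier [simp]:
  "H \<in> carrier_mat n n \<Longrightarrow> X \<in> carrier_mat n n \<Longrightarrow> comm_i H X \<in> carrier_mat n n"
  unfolding comm_i_def by (intro smult_carrier_mat minus_carrier_mat) simp

text \<open>The commutator does not change when \<open>H\<close> is shifted by a scalar, and shifting by the midpoint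
  of the spectrum minimises the norm of \<open>H\<close>.\<close>

lemma op_bounded_by_comm_i:
  assumes H: "H \<in> carrier_mat n n" and h: "mat_adjoint H = H" and n: "n > 0"
    and X: "X \<in> carrier_mat n n" and b: "op_bounded_by X b" "0 \<le> b"
  shows "op_bounded_by (comm_i H X) ((lam_max H - lam_min H) * b)"
proof -
  obtain W d where W: "W \<in> carrier_mat n n" "mat_adjoint W * W = 1\<^sub>m n" "W * mat_adjoint W = 1\<^sub>m n"
    and HW: "H = W * diag_of n (\<lambda>i. complex_of_real (d i)) * mat_adjoint W"
    and ev: "\<And>i. i < n \<Longrightarrow> H *\<^sub>v col W i = complex_of_real (d i) \<cdot>\<^sub>v col W i"
    and on: "\<And>i. i < n \<Longrightarrow> col W i \<bullet>c col W i = 1"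
    using hermitian_spectral_decomposition[OF H h] by metis
  have "eigenvalue H (complex_of_real (d i))" if i: "i < n" for i
    unfolding eigenvalue_def eigenvector_def
    using ev[OF i] on[OF i] W H i by (intro exI[of _ "col W i"]) auto
  then have d: "lam_min H \<le> d i" "d i \<le> lam_max H" if "i < n" for i
    using lam_bounds[OF H] that by auto
  define c where "c = (lam_max H + lam_min H) / 2"
  define \<omega> where "\<omega> = lam_max H - lam_min H"
  have \<omega>: "0 \<le> \<omega>" using lam_min_le_lam_max[OF H n] by (simp add: \<omega>_def)
  define D where "D = diag_of n (\<lambda>i. complex_of_real (d i - c))"
  have D: "D \<in> carrier_mat n n" by (simp add: D_def)
  define G where "G = W * D * mat_adjoint W"
  have G: "G \<in> carrier_mat n n" using W D by (simp add: G_def)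
  have dD: "diag_of n (\<lambda>i. complex_of_real (d i)) = D + complex_of_real c \<cdot>\<^sub>m 1\<^sub>m n"
    unfolding D_def diag_of_def by (rule eq_matI) auto
  have HG: "H = G + complex_of_real c \<cdot>\<^sub>m 1\<^sub>m n"
    unfolding HW dD G_def using W D
    by (simp add: mult_add_distrib_mat[of W n n D n] add_mult_distrib_mat[of _ n n _ _ n]
        mult_smult_distrib[of W n n _ n] mult_smult_assoc_mat[of W n n _ n])
  have "op_bounded_by D (\<omega> / 2)"
    unfolding D_def
  proof (rule op_bounded_by_diag_of)
    fix i assume "i < n"
    then show "cmod (complex_of_real (d i - c)) \<le> \<omega> / 2"
      using d[of i] unfolding norm_of_real \<omega>_def c_def by (auto simp: abs_le_iff field_simps)
  qed (use \<omega> in simp)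
  moreover have "op_bounded_by W 1" "op_bounded_by (mat_adjoint W) 1"
    using W by (auto intro!: op_bounded_by_isometry[of _ n] simp: mat_adjoint_adjoint)
  ultimately have "op_bounded_by (W * D * mat_adjoint W) (1 * (\<omega> / 2) * 1)"
    using W D \<omega> by (intro op_bounded_by_mult[of _ n n _ n]) auto
  then have oG: "op_bounded_by G (\<omega> / 2)" by (simp add: G_def)
  have "H * X - X * H = G * X - X * G"
    unfolding HG using G X
    by (intro eq_matI) (auto simp: add_mult_distrib_mat[of G n n] mult_add_distrib_mat[of X n n G n]
        mult_smult_distrib[of X n n _ n] mult_smult_assoc_mat[of _ n n X n] simp del: index_mult_mat(1))
  moreover have "op_bounded_by (G * X - X * G) (\<omega> / 2 * b + b * (\<omega> / 2))"
    using G X oG b \<omega> by (intro op_bounded_by_minus[of _ n n] op_bounded_by_mult[of _ n n _ n]) auto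
  ultimately show ?thesis
    using op_bounded_by_smult[of "G * X - X * G" "\<omega> / 2 * b + b * (\<omega> / 2)" \<i>]
    by (simp add: comm_i_def \<omega>_def algebra_simps)
qed

text \<open>In an eigenbasis of the density operator the trace is a convex combination of diagonal
  entries of the conjugated \<open>A\<close>: the weights d i are nonnegative by positivity and sum
  to the trace, which is 1. Each entry is at most b because conjugation by an isometry preserves the
  bound.\<close>

lemma cmod_mtrace_density_le:
  assumes \<rho>: "density_op n \<rho>" and A: "A \<in> carrier_mat (2^n) (2^n)" and b: "op_bounded_by A b" "0 \<le> b"
  shows "cmod (mtrace (\<rho> * A)) \<le> b"
proof -
  define N where "N = (2::nat)^n"
  have R: "\<rho> \<in> carrier_mat N N" and h: "mat_adjoint \<rho> = \<rho>"
    and pos: "\<And>v. v \<in> carrier_vec N \<Longrightarrow> 0 \<le> Re ((\<rho> *\<^sub>v v) \<bullet>c v)" and tr: "mtrace \<rho> = 1"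
    using \<rho> unfolding density_op_def hermitian_def N_def by auto
  have A: "A \<in> carrier_mat N N" using A by (simp add: N_def)
  obtain W d where W: "W \<in> carrier_mat N N" "mat_adjoint W * W = 1\<^sub>m N" "W * mat_adjoint W = 1\<^sub>m N"
    and RW: "\<rho> = W * diag_of N (\<lambda>i. complex_of_real (d i)) * mat_adjoint W"
    and ev: "\<And>i. i < N \<Longrightarrow> \<rho> *\<^sub>v col W i = complex_of_real (d i) \<cdot>\<^sub>v col W i"
    and on: "\<And>i. i < N \<Longrightarrow> col W i \<bullet>c col W i = 1"
    using hermitian_spectral_decomposition[OF R h] by metis
  have d: "0 \<le> d i" if i: "i < N" for i
    using pos[of "col W i"] ev[OF i] on[OF i] W i by (simp add: carrier_vecI)
  let ?D = "diag_of N (\<lambda>i. complex_of_real (d i))"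
  have trD: "mtrace (\<rho> * X) = (\<Sum>i<N. (mat_adjoint W * X * W) $$ (i,i) * complex_of_real (d i))"
    if X: "X \<in> carrier_mat N N" for X
  proof -
    have "mtrace (\<rho> * X) = mtrace (X * (W * ?D * mat_adjoint W))"
      using mtrace_mult_commute[OF R X] RW by simp
    also have "X * (W * ?D * mat_adjoint W) = (X * W * ?D) * mat_adjoint W"
      using X W by (simp add: assoc_mult_mat[of _ N N _ N _ N])
    also have "mtrace \<dots> = mtrace (mat_adjoint W * (X * W * ?D))"
      using X W by (intro mtrace_mult_commute[of _ N N]) auto
    also have "mat_adjoint W * (X * W * ?D) = mat_adjoint W * X * W * ?D"
      using X W by (simp add: assoc_mult_mat[of _ N N _ N _ N])
    also have "mtrace \<dots> = (\<Sum>i<N. (mat_adjoint W * X * W) $$ (i,i) * complex_of_real (d i))"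
      using X W unfolding mtrace_def
      by (auto simp: index_mult_diag_of[of _ N N] simp del: index_mult_mat(1) intro!: sum.cong)
    finally show ?thesis .
  qed
  have "mtrace (\<rho> * 1\<^sub>m N) = (\<Sum>i<N. complex_of_real (d i))"
    using W by (subst trD) auto
  then have sum1: "(\<Sum>i<N. d i) = 1"
    using tr R unfolding right_mult_one_mat[OF R] of_real_sum[symmetric] by (metis of_real_eq_1_iff)
  have "op_bounded_by (mat_adjoint W * A * W) (1 * b * 1)"
    using W A b by (intro op_bounded_by_mult[of _ N N _ N] op_bounded_by_isometry[of _ N]) (auto simp: mat_adjoint_adjoint)
  then have en: "cmod ((mat_adjoint W * A * W) $$ (i,i)) \<le> b" if "i < N" for i
    using W A that by (intro op_bounded_by_entry[of _ N]) auto
  have "cmod (mtrace (\<rho> * A)) \<le> (\<Sum>i<N. cmod ((mat_adjoint W * A * W) $$ (i,i) * complex_of_real (d i)))"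
    unfolding trD[OF A] by (rule norm_sum)
  also have "\<dots> \<le> (\<Sum>i<N. b * d i)"
    using en d by (intro sum_mono) (auto simp: norm_mult simp del: index_mult_mat(1) intro!: mult_right_mono)
  also have "\<dots> = b" using sum1 by (simp add: sum_distrib_left[symmetric])
  finally show ?thesis .
qed

section \<open>Legendre projection for functions with bounded partial derivatives\<close>

abbreviation unif :: "real \<Rightarrow> real \<Rightarrow> real measure" where
  "unif a r \<equiv> uniform_measure lborel {a - r .. a + r}"

lemma prob_space_unif: "0 < r \<Longrightarrow> prob_space (unif a r)"
  by (rule prob_space_uniform_measure) auto

lemma AE_unif: "AE x in unif a r. \<bar>x - a\<bar> \<le> r"
  by (rule AE_uniform_measureI) (auto simp: abs_le_iff)

lemma integrable_unif:
  fixes f :: "real \<Rightarrow> real"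
  assumes r: "0 < r" and f: "continuous_on UNIV f"
  shows "integrable (unif a r) f"
proof -
  interpret prob_space "unif a r" by (rule prob_space_unif[OF r])
  have "bounded (f ` {a - r..a + r})"
    using f by (intro compact_imp_bounded compact_continuous_image) (auto intro: continuous_on_subset)
  then obtain K where "\<forall>x\<in>{a - r..a + r}. \<bar>f x\<bar> \<le> K"
    unfolding bounded_iff by auto
  then have "AE x in unif a r. norm (f x) \<le> K"
    by (intro AE_mp[OF AE_unif[of a r] AE_I2]) (auto simp: abs_le_iff)
  moreover have "f \<in> borel_measurable (unif a r)"
    using borel_measurable_continuous_onI[OF f] by simp
  ultimately show ?thesis by (intro integrable_const_bound)
qed

lemma integral_unif:
  fixes f F :: "real \<Rightarrow> real"
  assumes r: "0 < r" and F: "\<And>x. (F has_real_derivative f x) (at x)" and f: "continuous_on UNIV f"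
  shows "(\<integral>x. f x \<partial>unif a r) = (F (a + r) - F (a - r)) / (2 * r)"
proof -
  have "(\<integral>x. f x \<partial>unif a r) = (\<integral>x. f x \<partial>density lborel (\<lambda>x. ennreal (indicator {a-r..a+r} x / (2 * r))))"
    unfolding uniform_measure_def using r
    by (intro arg_cong[where f = "\<lambda>M. integral\<^sup>L M f"] arg_cong[where f = "density lborel"] ext)
      (auto simp: divide_ennreal[symmetric] ennreal_indicator split: split_indicator)
  also have "\<dots> = (\<integral>x. (indicator {a-r..a+r} x / (2 * r)) *\<^sub>R f x \<partial>lborel)"
    using r borel_measurable_continuous_onI[OF f] by (intro integral_density) auto
  also have "\<dots> = (\<integral>x. (f x * indicator {a-r..a+r} x) / (2 * r) \<partial>lborel)"
    by (intro Bochner_Integration.integral_cong) auto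
  also have "\<dots> = (\<integral>x. f x * indicator {a-r..a+r} x \<partial>lborel) / (2 * r)"
    by simp
  also have "(\<integral>x. f x * indicator {a-r..a+r} x \<partial>lborel) = F (a + r) - F (a - r)"
    using r F f by (intro integral_FTC_Icc_real) (auto simp: continuous_on_eq_continuous_at)
  finally show ?thesis .
qed

text \<open>A non-integrable f has integral 0 by convention, and then C >= 0 is enough; a negative C
  would make the bound false almost everywhere. Inner integrals of an iterated integral can thus be
  bounded directly.\<close>

lemma (in prob_space) abs_integral_le_AE:
  fixes f :: "'a \<Rightarrow> real"
  assumes "AE x in M. \<bar>f x\<bar> \<le> C"
  shows "\<bar>\<integral>x. f x \<partial>M\<bar> \<le> C"
proof -
  have "\<bar>\<integral>x. f x \<partial>M\<bar> \<le> (\<integral>x. \<bar>f x\<bar> \<partial>M)" by (rule integral_abs_bound)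
  also have "\<dots> \<le> C"
  proof (cases "integrable M (\<lambda>x. \<bar>f x\<bar>)")
    case True
    then show ?thesis using assms by (intro integral_le_const)
  next
    case False
    have "0 \<le> C"
    proof (rule ccontr)
      assume "\<not> 0 \<le> C"
      then have "AE x in M. False"
        by (intro AE_mp[OF assms AE_I2] impI) linarith
      then show False by simp
    qed
    then show ?thesis using False by (simp add: not_integrable_integral_eq)
  qed
  finally show ?thesis .
qed

text \<open>This is the Lagrange remainder. \<open>Taylor\<close> asks for distinct points and
  positive order, so the cases x = a and n = 0 are treated apart.\<close>

lemma taylor_remainder:
  fixes D :: "nat \<Rightarrow> real \<Rightarrow> real"
  assumes D: "\<And>k x. k < n \<Longrightarrow> (D k has_real_derivative D (Suc k) x) (at x)"
    and C: "\<And>x. \<bar>D n x\<bar> \<le> C"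
  shows "\<bar>D 0 x - (\<Sum>k<n. D k a / fact k * (x - a) ^ k)\<bar> \<le> C / fact n * \<bar>x - a\<bar> ^ n"
proof (cases "x = a \<or> n = 0")
  case True
  have "0 \<le> C" using C[of a] by linarith
  consider "n = 0" | "x = a" "n > 0" using True by blast
  then show ?thesis
  proof cases
    case 2
    have "(\<Sum>k<n. D k a / fact k * 0 ^ k) = (\<Sum>k<n. if k = 0 then D 0 a else 0)"
      by (intro sum.cong) auto
    then show ?thesis using 2 \<open>0 \<le> C\<close> by simp
  qed (use C in simp)
next
  case False
  define lo hi where "lo = min x a" and "hi = max x a"
  have "\<exists>t. (if x < a then x < t \<and> t < a else a < t \<and> t < x) \<and>
      D 0 x = (\<Sum>k<n. D k a / fact k * (x - a) ^ k) + D n t / fact n * (x - a) ^ n"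
    using False D by (intro Taylor[of n D "D 0" lo hi a x]) (auto simp: lo_def hi_def)
  then obtain t where "D 0 x = (\<Sum>k<n. D k a / fact k * (x - a) ^ k) + D n t / fact n * (x - a) ^ n"
    by blast
  then have "\<bar>D 0 x - (\<Sum>k<n. D k a / fact k * (x - a) ^ k)\<bar> = \<bar>D n t\<bar> / fact n * \<bar>x - a\<bar> ^ n"
    by (simp add: abs_mult power_abs)
  also have "\<dots> \<le> C / fact n * \<bar>x - a\<bar> ^ n"
    by (intro mult_right_mono divide_right_mono C) auto
  finally show ?thesis .
qed

text \<open>The linear Taylor term is odd about the midpoint and averages to 0; the quadratic
  remainder is bounded pointwise using \<open>\<bar>x - a\<bar> \<le> r\<close>.\<close>

lemma unif_mean_deviation:
  fixes h h1 h2 :: "real \<Rightarrow> real"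
  assumes r: "0 < r" and d1: "\<And>x. (h has_real_derivative h1 x) (at x)"
    and d2: "\<And>x. (h1 has_real_derivative h2 x) (at x)" and C: "\<And>x. \<bar>h2 x\<bar> \<le> C"
  shows "\<bar>\<integral>x. h x - h a \<partial>unif a r\<bar> \<le> C * r\<^sup>2 / 2"
proof -
  interpret prob_space "unif a r" by (rule prob_space_unif[OF r])
  define D where "D k = [h, h1, h2] ! k" for k
  have "(D k has_real_derivative D (Suc k) x) (at x)" if "k < 2" for k x
    using that d1 d2 by (auto simp: D_def less_Suc_eq numeral_2_eq_2)
  from taylor_remainder[where D = D and n = 2, OF this, of C]
  have T: "\<bar>h x - (h a + h1 a * (x - a))\<bar> \<le> C / 2 * \<bar>x - a\<bar>\<^sup>2" for x
    using C by (simp add: D_def numeral_2_eq_2)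
  have C0: "0 \<le> C" using C[of a] by linarith
  have ch: "continuous_on UNIV h"
    using d1 by (meson DERIV_isCont continuous_at_imp_continuous_on)
  have lin: "(\<integral>x. h1 a * (x - a) \<partial>unif a r) = 0"
    by (subst integral_unif[OF r, where F = "\<lambda>x. h1 a * (x - a)\<^sup>2 / 2"])
      (auto intro!: derivative_eq_intros continuous_intros)
  have "(\<integral>x. (h x - h a) - h1 a * (x - a) \<partial>unif a r)
      = (\<integral>x. h x - h a \<partial>unif a r) - (\<integral>x. h1 a * (x - a) \<partial>unif a r)"
    using r ch by (intro Bochner_Integration.integral_diff integrable_unif continuous_intros)
  then have "(\<integral>x. h x - h a \<partial>unif a r) = (\<integral>x. (h x - h a) - h1 a * (x - a) \<partial>unif a r)"
    unfolding lin by linarith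
  moreover have "\<bar>\<integral>x. (h x - h a) - h1 a * (x - a) \<partial>unif a r\<bar> \<le> C * r\<^sup>2 / 2"
  proof (rule abs_integral_le_AE, rule AE_mp[OF AE_unif AE_I2], rule impI)
    fix x assume "\<bar>x - a\<bar> \<le> r"
    then have "\<bar>x - a\<bar>\<^sup>2 \<le> r\<^sup>2" by (intro power_mono) auto
    then have "C / 2 * \<bar>x - a\<bar>\<^sup>2 \<le> C / 2 * r\<^sup>2" using C0 by (intro mult_left_mono) auto
    then show "\<bar>(h x - h a) - h1 a * (x - a)\<bar> \<le> C * r\<^sup>2 / 2"
      using T[of x] by (simp add: algebra_simps)
  qed
  ultimately show ?thesis by metis
qed

text \<open>Up to scaling, \<open>y\<^sup>2 - r\<^sup>2 / 3\<close> is the second Legendre polynomial on \<open>[- r, r]\<close>; pairing with it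
  isolates the second derivative of \<open>h\<close> at the midpoint.\<close>

lemma unif_legendre_coefficient:
  fixes D :: "nat \<Rightarrow> real \<Rightarrow> real"
  assumes r: "0 < r" and d: "\<And>k x. k < 4 \<Longrightarrow> (D k has_real_derivative D (Suc k) x) (at x)"
    and C: "\<And>x. \<bar>D 4 x\<bar> \<le> C"
  shows "\<bar>\<integral>x. D 0 x * ((x - a)\<^sup>2 - r\<^sup>2 / 3) - 2 * r ^ 4 / 45 * D 2 a \<partial>unif a r\<bar> \<le> C * r ^ 6 / 36"
proof -
  interpret prob_space "unif a r" by (rule prob_space_unif[OF r])
  define T where "T x = (D 0 a + D 1 a * (x - a) + D 2 a / 2 * (x - a)\<^sup>2 + D 3 a / 6 * (x - a) ^ 3)" for x
  define P where "P x = (x - a)\<^sup>2 - r\<^sup>2 / 3" for x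
  have T: "\<bar>D 0 x - T x\<bar> \<le> C / 24 * \<bar>x - a\<bar> ^ 4" for x
  proof -
    have "(\<Sum>k<4. D k a / fact k * (x - a) ^ k) = T x"
      unfolding T_def by (simp add: eval_nat_numeral)
    then show ?thesis
      using taylor_remainder[where D = D and n = 4, OF d C, of x a] by (simp add: fact_numeral)
  qed
  have C0: "0 \<le> C" using C[of a] by linarith
  have cD: "continuous_on UNIV (D 0)"
    using d[of 0] by (meson DERIV_isCont continuous_at_imp_continuous_on zero_less_numeral)
  have cT: "continuous_on UNIV T" and cP: "continuous_on UNIV P"
    unfolding T_def P_def by (auto intro!: continuous_intros)
  \<comment> \<open>An antiderivative of T P. Its D 1 and D 3 terms are even about a, and its D 0
    term vanishes at a - r and a + r, so only D 2 contributes: (1/5 - 1/9) / 2 = 2/45.\<close>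
  define F where "F x = D 0 a * ((x - a) ^ 3 / 3 - r\<^sup>2 * (x - a) / 3) + D 1 a * ((x - a) ^ 4 / 4 - r\<^sup>2 * (x - a)\<^sup>2 / 6)
     + D 2 a / 2 * ((x - a) ^ 5 / 5 - r\<^sup>2 * (x - a) ^ 3 / 9) + D 3 a / 6 * ((x - a) ^ 6 / 6 - r\<^sup>2 * (x - a) ^ 4 / 12)" for x
  have F: "(F has_real_derivative T x * P x) (at x)" for x
    unfolding F_def T_def P_def
    by (rule derivative_eq_intros refl | simp)+ (simp add: field_simps eval_nat_numeral)
  have "(\<integral>x. T x * P x \<partial>unif a r) = (F (a + r) - F (a - r)) / (2 * r)"
    using F cT cP by (intro integral_unif[OF r]) (auto intro!: continuous_intros)
  also have "\<dots> = 2 * r ^ 4 / 45 * D 2 a"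
    using r by (simp add: F_def field_simps eval_nat_numeral)
  finally have TP: "(\<integral>x. T x * P x \<partial>unif a r) = 2 * r ^ 4 / 45 * D 2 a" .
  have "(\<integral>x. D 0 x * P x - 2 * r ^ 4 / 45 * D 2 a \<partial>unif a r) = (\<integral>x. (D 0 x - T x) * P x \<partial>unif a r)"
    unfolding left_diff_distrib using r cD cT cP
    by (subst (1 2) Bochner_Integration.integral_diff) (auto intro!: integrable_unif continuous_intros simp: TP prob_space)
  moreover have "\<bar>\<integral>x. (D 0 x - T x) * P x \<partial>unif a r\<bar> \<le> C * r ^ 6 / 36"
  proof (rule abs_integral_le_AE, rule AE_mp[OF AE_unif AE_I2], rule impI)
    fix x assume x: "\<bar>x - a\<bar> \<le> r"
    then have "\<bar>x - a\<bar> ^ 4 \<le> r ^ 4" by (intro power_mono) auto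
    then have 1: "\<bar>D 0 x - T x\<bar> \<le> C / 24 * r ^ 4"
      using T[of x] mult_left_mono[of "\<bar>x - a\<bar> ^ 4" "r ^ 4" "C / 24"] C0 by simp
    \<comment> \<open>P ranges over [-r^2/3, 2r^2/3]. Together with the Taylor constant this gives
      1/24 times 2/3 = 1/36.\<close>
    have "(x - a)\<^sup>2 \<le> r\<^sup>2" using power_mono[OF x, of 2] by simp
    moreover have "0 \<le> (x - a)\<^sup>2" "0 \<le> r\<^sup>2" by simp_all
    ultimately have 2: "\<bar>P x\<bar> \<le> 2 / 3 * r\<^sup>2" unfolding P_def abs_le_iff by linarith
    have "\<bar>(D 0 x - T x) * P x\<bar> \<le> (C / 24 * r ^ 4) * (2 / 3 * r\<^sup>2)"
      unfolding abs_mult by (intro mult_mono 1 2) (use C0 in auto)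
    also have "\<dots> = C * r ^ 6 / 36" by (simp add: power_add[symmetric])
    finally show "\<bar>(D 0 x - T x) * P x\<bar> \<le> C * r ^ 6 / 36" .
  qed
  ultimately show ?thesis by (simp add: P_def)
qed

text \<open>Because P has mean 0, subtracting the mean of the loss does not change its pairing with
  P. The second moment comes from 1/5 - 2/9 + 1/9 = 4/45.\<close>

lemma unif_legendre_moments:
  assumes r: "0 < r"
  shows "(\<integral>x. (x - a)\<^sup>2 - r\<^sup>2 / 3 \<partial>unif a r) = 0"
    and "(\<integral>x. ((x - a)\<^sup>2 - r\<^sup>2 / 3)\<^sup>2 \<partial>unif a r) = 4 * r ^ 4 / 45"
proof -
  have 1: "((\<lambda>x. (x - a) ^ 3 / 3 - r\<^sup>2 * (x - a) / 3) has_real_derivative (x - a)\<^sup>2 - r\<^sup>2 / 3) (at x)" for x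
    by (rule derivative_eq_intros refl | simp)+
  show "(\<integral>x. (x - a)\<^sup>2 - r\<^sup>2 / 3 \<partial>unif a r) = 0"
    using r by (subst integral_unif[OF r 1]) (auto intro!: continuous_intros simp: eval_nat_numeral)
  have 2: "((\<lambda>x. (x - a) ^ 5 / 5 - 2 * r\<^sup>2 * (x - a) ^ 3 / 9 + r ^ 4 * (x - a) / 9)
      has_real_derivative ((x - a)\<^sup>2 - r\<^sup>2 / 3)\<^sup>2) (at x)" for x
    by (rule derivative_eq_intros refl | simp)+ (simp add: field_simps eval_nat_numeral)
  show "(\<integral>x. ((x - a)\<^sup>2 - r\<^sup>2 / 3)\<^sup>2 \<partial>unif a r) = 4 * r ^ 4 / 45"
    using r by (subst integral_unif[OF r 2]) (auto intro!: continuous_intros simp: field_simps eval_nat_numeral)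
qed

section \<open>Averages over the box\<close>

text \<open>Fubini in the coordinate q. A one-dimensional estimate that is uniform in the other
  coordinates passes to the product measure; every estimate over the box below is reduced to an
  interval in this way.\<close>

lemma (in product_prob_space) abs_integral_PiM_le:
  fixes f g :: "('i \<Rightarrow> 'a) \<Rightarrow> real"
  assumes I: "finite I" and q: "q \<in> I"
    and int: "integrable (PiM I M) f" "integrable (PiM I M) g"
    and C: "\<And>x. x \<in> space (PiM (I - {q}) M) \<Longrightarrow> \<bar>\<integral>y. f (x(q := y)) - g (x(q := y)) \<partial>M q\<bar> \<le> C"
  shows "\<bar>(\<integral>x. f x \<partial>PiM I M) - (\<integral>x. g x \<partial>PiM I M)\<bar> \<le> C"
proof -
  interpret J: prob_space "PiM (I - {q}) M" by (intro prob_space_PiM prob_space)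
  have Iq: "insert q (I - {q}) = I" using q by auto
  have "(\<integral>x. f x \<partial>PiM I M) - (\<integral>x. g x \<partial>PiM I M) = (\<integral>x. f x - g x \<partial>PiM I M)"
    using int by simp
  also have "\<dots> = (\<integral>x. (\<integral>y. f (x(q := y)) - g (x(q := y)) \<partial>M q) \<partial>PiM (I - {q}) M)"
    using product_integral_insert[of "I - {q}" q "\<lambda>x. f x - g x"] I int unfolding Iq by simp
  finally show ?thesis
    using J.abs_integral_le_AE[OF AE_I2, of "\<lambda>x. \<integral>y. f (x(q := y)) - g (x(q := y)) \<partial>M q" C] C by simp
qed

text \<open>What the averaging argument needs of the loss: \<open>F qs\<close> is the iterated
  partial derivative along \<open>qs\<close>. Measurability is asked for compositions with a map g
  because the family is evaluated with some coordinates frozen at \<phi>; \<open>cong_F\<close> says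
  that coordinates from m on do not matter.\<close>

locale derivative_family =
  fixes m :: nat and F :: "nat list \<Rightarrow> (nat \<Rightarrow> real) \<Rightarrow> real" and b :: real and w :: "nat \<Rightarrow> real"
  assumes deriv_F: "\<And>qs \<theta> q t. q < m \<Longrightarrow>
      ((\<lambda>t. F qs (\<theta>(q := t))) has_real_derivative F (q # qs) (\<theta>(q := t))) (at t)"
    and bound_F: "\<And>qs \<theta>. set qs \<subseteq> {..<m} \<Longrightarrow> \<bar>F qs \<theta>\<bar> \<le> b * prod_list (map w qs)"
    and meas_F: "\<And>qs (N :: (nat \<Rightarrow> real) measure) g. (\<And>i. i < m \<Longrightarrow> (\<lambda>x. g x i) \<in> borel_measurable N) \<Longrightarrow>
      (\<lambda>x. F qs (g x)) \<in> borel_measurable N"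
    and cong_F: "\<And>qs \<theta> \<theta>'. (\<And>i. i < m \<Longrightarrow> \<theta> i = \<theta>' i) \<Longrightarrow> F qs \<theta> = F qs \<theta>'"
begin

context
  fixes \<phi> :: "nat \<Rightarrow> real" and r :: real and p :: nat
  assumes r: "0 < r" and p: "p < m"
begin

interpretation product_prob_space "\<lambda>i. unif (\<phi> i) r" "{..<m}"
  using prob_space_unif[OF r]
  by (auto simp: product_prob_space_def product_prob_space_axioms_def product_sigma_finite_def
      prob_space_imp_sigma_finite)

interpretation box: prob_space "unif_box m \<phi> r"
  unfolding unif_box_def by (intro prob_space_PiM prob_space_unif r)

lemma measurable_unif_box_component: "i < m \<Longrightarrow> (\<lambda>x. x i) \<in> borel_measurable (unif_box m \<phi> r)"
  unfolding unif_box_def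
  using measurable_component_singleton[of i "{..<m}" "\<lambda>i. unif (\<phi> i) r"] by (simp cong: measurable_cong_sets)

lemma measurable_override:
  "i < m \<Longrightarrow> (\<lambda>x. if i \<in> J then x i else \<phi> i) \<in> borel_measurable (unif_box m \<phi> r)"
  by (cases "i \<in> J") (auto intro: measurable_unif_box_component)

text \<open>The bound is asked only where the p-th coordinate lies in its interval, which holds
  almost surely: the members of the family are bounded everywhere, but P is not.\<close>

lemma integrable_unif_box:
  assumes "f \<in> borel_measurable (unif_box m \<phi> r)" "\<And>\<theta>. \<bar>\<theta> p - \<phi> p\<bar> \<le> r \<Longrightarrow> \<bar>f \<theta>\<bar> \<le> K"
  shows "integrable (unif_box m \<phi> r) (f :: _ \<Rightarrow> real)"
proof -
  have "AE \<theta> in unif_box m \<phi> r. \<bar>\<theta> p - \<phi> p\<bar> \<le> r"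
    unfolding unif_box_def using p prob_space_unif[OF r]
    by (intro AE_PiM_component[where P = "\<lambda>x. \<bar>x - \<phi> p\<bar> \<le> r"] AE_unif) auto
  then show ?thesis
    using assms by (intro box.integrable_const_bound[where B = K]) (auto elim!: AE_mp)
qed

text \<open>A telescoping sum: coordinates outside J stay frozen at \<phi>, and freeing one more q
  costs half of r^2 times a bound on the second derivative in q. Freezing coordinates, rather than
  integrating fewer of them, keeps every stage an integral over the same measure.\<close>

lemma mean_deviation_family:
  assumes "finite J" "J \<subseteq> {..<m} - {p}" and qs: "set qs \<subseteq> {..<m}"
  shows "\<bar>(\<integral>\<theta>. F qs (\<lambda>i. if i \<in> J then \<theta> i else \<phi> i) \<partial>unif_box m \<phi> r) - F qs \<phi>\<bar>
    \<le> (\<Sum>q\<in>J. b * prod_list (map w qs) * (w q)\<^sup>2 * r\<^sup>2 / 2)"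
  using assms(1,2)
proof (induction J rule: finite_induct)
  case empty
  then show ?case by (simp add: box.prob_space)
next
  case (insert q J)
  define G where "G J \<theta> = F qs (\<lambda>i. if i \<in> J then \<theta> i else \<phi> i)" for J \<theta>
  have int: "integrable (unif_box m \<phi> r) (G J)" for J
    unfolding G_def using bound_F[OF qs]
    by (intro integrable_unif_box meas_F measurable_override)
  have q: "q < m" using insert by auto
  have "\<bar>(\<integral>\<theta>. G (insert q J) \<theta> \<partial>unif_box m \<phi> r) - (\<integral>\<theta>. G J \<theta> \<partial>unif_box m \<phi> r)\<bar>
      \<le> b * prod_list (map w qs) * (w q)\<^sup>2 * r\<^sup>2 / 2"
    unfolding unif_box_def
  proof (rule abs_integral_PiM_le)
    fix x :: "nat \<Rightarrow> real"
    define x' where "x' = (\<lambda>i. if i \<in> J then x i else \<phi> i)"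
    have "G (insert q J) (x(q := y)) = F qs (x'(q := y))" for y
      unfolding G_def x'_def by (rule arg_cong[where f = "F qs"]) (use insert in auto)
    moreover have "G J (x(q := y)) = F qs (x'(q := \<phi> q))" for y
      unfolding G_def x'_def by (rule arg_cong[where f = "F qs"]) (use insert in auto)
    moreover have "\<bar>F (q # q # qs) \<theta>\<bar> \<le> b * prod_list (map w qs) * (w q)\<^sup>2" for \<theta>
      using bound_F[of "q # q # qs" \<theta>] qs q by (simp add: power2_eq_square mult_ac)
    ultimately show "\<bar>\<integral>y. G (insert q J) (x(q := y)) - G J (x(q := y)) \<partial>unif (\<phi> q) r\<bar>
        \<le> b * prod_list (map w qs) * (w q)\<^sup>2 * r\<^sup>2 / 2"
      using unif_mean_deviation[OF r deriv_F[OF q] deriv_F[OF q], of qs x' "b * prod_list (map w qs) * (w q)\<^sup>2" "\<phi> q"]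
      by simp
  qed (use int q in \<open>auto simp: unif_box_def\<close>)
  moreover have "\<bar>(\<integral>\<theta>. G J \<theta> \<partial>unif_box m \<phi> r) - F qs \<phi>\<bar> \<le> (\<Sum>q\<in>J. b * prod_list (map w qs) * (w q)\<^sup>2 * r\<^sup>2 / 2)"
    using insert unfolding G_def by auto
  ultimately show ?case
    unfolding G_def sum.insert[OF insert.hyps] by linarith
qed

text \<open>The marginal of the box, read off from \<open>abs_integral_PiM_le\<close> with bound
  0.\<close>

lemma integral_unif_box_component:
  assumes f: "continuous_on UNIV f"
  shows "(\<integral>\<theta>. f (\<theta> p) \<partial>unif_box m \<phi> r) = (\<integral>x. f x \<partial>unif (\<phi> p) r :: real)"
proof -
  have "bounded (f ` {\<phi> p - r..\<phi> p + r})"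
    using f by (intro compact_imp_bounded compact_continuous_image) (auto intro: continuous_on_subset)
  then obtain K where "\<forall>x\<in>{\<phi> p - r..\<phi> p + r}. \<bar>f x\<bar> \<le> K"
    unfolding bounded_iff by auto
  then have K: "\<bar>f x\<bar> \<le> K" if "\<bar>x - \<phi> p\<bar> \<le> r" for x
    using that by (auto simp: abs_le_iff)
  have int: "integrable (unif_box m \<phi> r) (\<lambda>\<theta>. f (\<theta> p))"
    using K measurable_compose[OF measurable_unif_box_component[OF p] borel_measurable_continuous_onI[OF f]]
    by (intro integrable_unif_box) auto
  have "\<bar>(\<integral>\<theta>. f (\<theta> p) \<partial>unif_box m \<phi> r) - (\<integral>\<theta>. (\<integral>x. f x \<partial>unif (\<phi> p) r) \<partial>unif_box m \<phi> r)\<bar> \<le> 0"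
    unfolding unif_box_def
  proof (rule abs_integral_PiM_le)
    show "integrable (Pi\<^sub>M {..<m} (\<lambda>i. unif (\<phi> i) r)) (\<lambda>\<theta>. \<integral>x. f x \<partial>unif (\<phi> p) r)"
      using box.integrable_const unfolding unif_box_def .
    fix x :: "nat \<Rightarrow> real"
    have "measure (unif (\<phi> p) r) UNIV = 1"
      using prob_space.prob_space[OF prob_space_unif[OF r, of "\<phi> p"]] by simp
    then have "(\<integral>y. f y - (\<integral>x. f x \<partial>unif (\<phi> p) r) \<partial>unif (\<phi> p) r) = 0"
      using integrable_unif[OF r f, of "\<phi> p"] by (subst Bochner_Integration.integral_diff) auto
    then show "\<bar>\<integral>y. f ((x(p := y)) p) - (\<integral>x. f x \<partial>unif (\<phi> p) r) \<partial>unif (\<phi> p) r\<bar> \<le> 0"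
      by simp
  qed (use int p in \<open>auto simp: unif_box_def\<close>)
  then show ?thesis by (simp add: box.prob_space)
qed

lemma variance_family:
  obtains K where "variance_on (unif_box m \<phi> r) (F []) \<ge> 45 / (4 * r ^ 4) * K\<^sup>2"
    and "\<bar>K - 2 * r ^ 4 / 45 * F [p, p] \<phi>\<bar> \<le> b * w p ^ 4 * r ^ 6 / 36
       + 2 * r ^ 4 / 45 * (b * (w p)\<^sup>2 * (\<Sum>q\<in>{..<m} - {p}. (w q)\<^sup>2) * r\<^sup>2 / 2)"
proof -
  let ?\<mu> = "unif_box m \<phi> r"
  define P where "P x = (x - \<phi> p)\<^sup>2 - r\<^sup>2 / 3" for x
  have cP: "continuous_on UNIV P" unfolding P_def by (intro continuous_intros)
  have bP: "\<bar>P x\<bar> \<le> r\<^sup>2" if "\<bar>x - \<phi> p\<bar> \<le> r" for x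
  proof -
    have "(x - \<phi> p)\<^sup>2 \<le> r\<^sup>2" using power_mono[OF that, of 2] by simp
    moreover have "0 \<le> (x - \<phi> p)\<^sup>2" "0 \<le> r\<^sup>2" by simp_all
    ultimately show ?thesis unfolding P_def abs_le_iff by linarith
  qed
  define L where "L = F []"
  have bL: "\<bar>L \<theta>\<bar> \<le> b" for \<theta> using bound_F[of "[]"] by (simp add: L_def)
  have b0: "0 \<le> b" using bL[of \<phi>] by linarith
  have mL: "L \<in> borel_measurable ?\<mu>"
    using meas_F[of "\<lambda>x. x" ?\<mu> "[]"] measurable_unif_box_component by (simp add: L_def)
  have mP: "(\<lambda>\<theta>. P (\<theta> p)) \<in> borel_measurable ?\<mu>"
    using measurable_compose[OF measurable_unif_box_component[OF p] borel_measurable_continuous_onI[OF cP]] .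
  have iL: "integrable ?\<mu> L" using bL mL by (intro integrable_unif_box)
  have iP: "integrable ?\<mu> (\<lambda>\<theta>. P (\<theta> p))" using bP mP by (intro integrable_unif_box)
  have iLP: "integrable ?\<mu> (\<lambda>\<theta>. L \<theta> * P (\<theta> p))"
    using bP mP mL bL b0 by (intro integrable_unif_box[where K = "b * r\<^sup>2"]) (auto simp: abs_mult intro!: mult_mono)
  have iPP: "integrable ?\<mu> (\<lambda>\<theta>. (P (\<theta> p))\<^sup>2)"
  proof (rule integrable_unif_box[where K = "(r\<^sup>2)\<^sup>2"])
    fix \<theta> :: "nat \<Rightarrow> real" assume "\<bar>\<theta> p - \<phi> p\<bar> \<le> r"
    then show "\<bar>(P (\<theta> p))\<^sup>2\<bar> \<le> (r\<^sup>2)\<^sup>2"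
      using power_mono[OF bP, of "\<theta> p" 2] by simp
  qed (use mP in simp)
  define e where "e = (\<integral>\<theta>. L \<theta> \<partial>?\<mu>)"
  have iV: "integrable ?\<mu> (\<lambda>\<theta>. (L \<theta> - e)\<^sup>2)"
  proof (rule integrable_unif_box[where K = "(b + \<bar>e\<bar>)\<^sup>2"])
    fix \<theta> :: "nat \<Rightarrow> real"
    have "\<bar>L \<theta> - e\<bar> \<le> b + \<bar>e\<bar>" using bL[of \<theta>] by linarith
    then show "\<bar>(L \<theta> - e)\<^sup>2\<bar> \<le> (b + \<bar>e\<bar>)\<^sup>2" using power_mono[of "\<bar>L \<theta> - e\<bar>" "b + \<bar>e\<bar>" 2] by simp
  qed (use mL in simp)
  have EP: "(\<integral>\<theta>. P (\<theta> p) \<partial>?\<mu>) = 0"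
    using unif_legendre_moments(1)[OF r] integral_unif_box_component[OF cP] by (simp add: P_def)
  have EPP: "(\<integral>\<theta>. (P (\<theta> p))\<^sup>2 \<partial>?\<mu>) = 4 * r ^ 4 / 45"
    using unif_legendre_moments(2)[OF r] integral_unif_box_component[of "\<lambda>x. (P x)\<^sup>2"] cP
    by (simp add: P_def continuous_intros)
  define K where "K = (\<integral>\<theta>. L \<theta> * P (\<theta> p) \<partial>?\<mu>)"
  define v where "v = variance_on ?\<mu> (F [])"
  \<comment> \<open>t = K / E[P^2] minimises E[((L - e) - t P)^2]. That this minimum is nonnegative
    is the Cauchy-Schwarz inequality; the term in e drops out since E[P] = 0.\<close>
  define t where "t = 45 / (4 * r ^ 4) * K"
  have "0 \<le> (\<integral>\<theta>. ((L \<theta> - e) - t * P (\<theta> p))\<^sup>2 \<partial>?\<mu>)" by simp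
  also have "\<dots> = (\<integral>\<theta>. (L \<theta> - e)\<^sup>2 - 2 * t * (L \<theta> * P (\<theta> p)) + 2 * t * e * P (\<theta> p) + t\<^sup>2 * (P (\<theta> p))\<^sup>2 \<partial>?\<mu>)"
    by (intro Bochner_Integration.integral_cong) (auto simp: power2_eq_square algebra_simps)
  also have "\<dots> = v - 2 * t * K + t\<^sup>2 * (4 * r ^ 4 / 45)"
    using iV iP iLP iPP by (simp add: EP EPP K_def v_def variance_on_def L_def[symmetric] e_def[symmetric])
  also have "\<dots> = v - 45 / (4 * r ^ 4) * K\<^sup>2"
    using r by (simp add: t_def power2_eq_square field_simps)
  finally have 1: "variance_on ?\<mu> (F []) \<ge> 45 / (4 * r ^ 4) * K\<^sup>2" by (simp add: v_def)
  \<comment> \<open>The second derivative with the p-th coordinate frozen at its midpoint and all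
    others free. It is constant along p, so the interval estimate for the Legendre coefficient
    applies inside the Fubini integral.\<close>
  define H where "H \<theta> = F [p,p] (\<lambda>i. if i \<in> {..<m} - {p} then \<theta> i else \<phi> i)" for \<theta>
  have iH: "integrable ?\<mu> (\<lambda>\<theta>. 2 * r ^ 4 / 45 * H \<theta>)"
  proof -
    have "integrable ?\<mu> H"
      unfolding H_def using bound_F[of "[p,p]"] p
      by (intro integrable_unif_box[where K = "b * (w p * w p)"] meas_F measurable_override) auto
    then show ?thesis by simp
  qed
  have 2: "\<bar>K - (\<integral>\<theta>. 2 * r ^ 4 / 45 * H \<theta> \<partial>?\<mu>)\<bar> \<le> b * w p ^ 4 * r ^ 6 / 36"
    unfolding K_def unif_box_def
  proof (rule abs_integral_PiM_le)
    fix x :: "nat \<Rightarrow> real"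
    define D where "D k y = F (replicate k p) (x(p := y))" for k y
    have "H (x(p := y)) = D 2 (\<phi> p)" for y
      unfolding H_def D_def numeral_2_eq_2 by (auto intro!: cong_F)
    moreover have "L (x(p := y)) = D 0 y" for y by (simp add: D_def L_def)
    moreover have "(D k has_real_derivative D (Suc k) y) (at y)" for k y
      unfolding D_def using deriv_F[OF p, of "replicate k p" x y] by simp
    moreover have "\<bar>D 4 y\<bar> \<le> b * w p ^ 4" for y
      using bound_F[of "replicate 4 p" "x(p := y)"] p by (simp add: D_def prod_list_replicate)
    ultimately show "\<bar>\<integral>y. L (x(p := y)) * P ((x(p := y)) p) - 2 * r ^ 4 / 45 * H (x(p := y)) \<partial>unif (\<phi> p) r\<bar>
       \<le> b * w p ^ 4 * r ^ 6 / 36"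
      using unif_legendre_coefficient[OF r, of D "b * w p ^ 4" "\<phi> p"] by (simp add: P_def)
  qed (use iLP iH p in \<open>auto simp: unif_box_def\<close>)
  have "\<bar>(\<integral>\<theta>. H \<theta> \<partial>?\<mu>) - F [p,p] \<phi>\<bar> \<le> (\<Sum>q\<in>{..<m} - {p}. b * prod_list (map w [p,p]) * (w q)\<^sup>2 * r\<^sup>2 / 2)"
    unfolding H_def using p by (intro mean_deviation_family) auto
  also have "\<dots> = b * (w p)\<^sup>2 * (\<Sum>q\<in>{..<m} - {p}. (w q)\<^sup>2) * r\<^sup>2 / 2"
    by (simp add: sum_distrib_left sum_distrib_right sum_divide_distrib power2_eq_square mult_ac)
  finally have "2 * r ^ 4 / 45 * \<bar>(\<integral>\<theta>. H \<theta> \<partial>?\<mu>) - F [p,p] \<phi>\<bar>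
      \<le> 2 * r ^ 4 / 45 * (b * (w p)\<^sup>2 * (\<Sum>q\<in>{..<m} - {p}. (w q)\<^sup>2) * r\<^sup>2 / 2)"
    by (intro mult_left_mono) auto
  moreover have "2 * r ^ 4 / 45 * \<bar>(\<integral>\<theta>. H \<theta> \<partial>?\<mu>) - F [p,p] \<phi>\<bar>
     = \<bar>(\<integral>\<theta>. 2 * r ^ 4 / 45 * H \<theta> \<partial>?\<mu>) - 2 * r ^ 4 / 45 * F [p,p] \<phi>\<bar>"
  proof -
    have "(\<integral>\<theta>. 2 * r ^ 4 / 45 * H \<theta> \<partial>?\<mu>) - 2 * r ^ 4 / 45 * F [p,p] \<phi> = 2 * r ^ 4 / 45 * ((\<integral>\<theta>. H \<theta> \<partial>?\<mu>) - F [p,p] \<phi>)"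
      by (simp add: right_diff_distrib)
    then have "\<bar>(\<integral>\<theta>. 2 * r ^ 4 / 45 * H \<theta> \<partial>?\<mu>) - 2 * r ^ 4 / 45 * F [p,p] \<phi>\<bar>
        = \<bar>2 * r ^ 4 / 45\<bar> * \<bar>(\<integral>\<theta>. H \<theta> \<partial>?\<mu>) - F [p,p] \<phi>\<bar>"
      by (simp only: abs_mult)
    then show ?thesis by simp
  qed
  ultimately have "\<bar>K - 2 * r ^ 4 / 45 * F [p, p] \<phi>\<bar> \<le> b * w p ^ 4 * r ^ 6 / 36
       + 2 * r ^ 4 / 45 * (b * (w p)\<^sup>2 * (\<Sum>q\<in>{..<m} - {p}. (w q)\<^sup>2) * r\<^sup>2 / 2)"
    using 2 by linarith
  with 1 show ?thesis using that by blast
qed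

end

end

section \<open>Exponentials of Hermitian matrices\<close>

lemma mat_adjoint_diag_of: "mat_adjoint (diag_of n f) = diag_of n (\<lambda>i. cnj (f i))"
  by (rule eq_matI) (auto simp: index_mat_adjoint index_diag_of carrier_matD[OF diag_of_carrier])

lemma index_spectral:
  assumes W: "W \<in> carrier_mat n n" and ij: "i < n" "j < n"
  shows "(W * diag_of n f * mat_adjoint W) $$ (i,j) = (\<Sum>a<n. W $$ (i,a) * f a * cnj (W $$ (j,a)))"
proof -
  have "(W * diag_of n f * mat_adjoint W) $$ (i,j) = (\<Sum>a<n. (W * diag_of n f) $$ (i,a) * mat_adjoint W $$ (a,j))"
    using W ij by (intro index_mult_mat_sum[of _ n n _ n]) auto
  then show ?thesis
    using W ij by (simp add: index_mult_diag_of[of W n n] index_mat_adjoint del: index_mult_mat(1))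
qed

lemma spectral_mult:
  assumes W: "W \<in> carrier_mat n n" and WW: "mat_adjoint W * W = 1\<^sub>m n"
  shows "(W * diag_of n f * mat_adjoint W) * (W * diag_of n g * mat_adjoint W)
    = W * diag_of n (\<lambda>i. f i * g i) * mat_adjoint W"
proof -
  let ?D = "diag_of n f" and ?E = "diag_of n g"
  have "(W * ?D * mat_adjoint W) * (W * ?E * mat_adjoint W) = W * ?D * (mat_adjoint W * W) * (?E * mat_adjoint W)"
    using W by (simp add: assoc_mult_mat[of _ n n _ n _ n])
  also have "\<dots> = W * (?D * ?E) * mat_adjoint W"
    using W unfolding WW by (simp add: assoc_mult_mat[of _ n n _ n _ n] left_mult_one_mat[of _ n n])
  finally show ?thesis by (simp add: diag_of_mult)
qed

lemma spectral_one:
  assumes W: "W \<in> carrier_mat n n" and WW: "W * mat_adjoint W = 1\<^sub>m n"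
  shows "W * diag_of n (\<lambda>_. 1) * mat_adjoint W = 1\<^sub>m n"
proof -
  have "diag_of n (\<lambda>_. 1) = 1\<^sub>m n" by (rule eq_matI) (auto simp: diag_of_def)
  then show ?thesis using W WW by simp
qed

lemma spectral_power:
  assumes W: "W \<in> carrier_mat n n" and WW: "mat_adjoint W * W = 1\<^sub>m n" "W * mat_adjoint W = 1\<^sub>m n"
  shows "(W * diag_of n f * mat_adjoint W) ^\<^sub>m k = W * diag_of n (\<lambda>i. f i ^ k) * mat_adjoint W"
proof (induction k)
  case 0
  then show ?case using W by (simp add: spectral_one[OF W WW(2)])
next
  case (Suc k)
  then show ?case by (simp add: spectral_mult[OF W WW(1)] mult.commute)
qed

text \<open>Powers of the conjugated diagonal matrix are diagonal in the same basis, so each entry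
  of the series is a finite combination of scalar exponential series.\<close>

lemma mat_exp_spectral:
  assumes W: "W \<in> carrier_mat n n" and WW: "mat_adjoint W * W = 1\<^sub>m n" "W * mat_adjoint W = 1\<^sub>m n"
  shows "mat_exp (W * diag_of n f * mat_adjoint W) = W * diag_of n (\<lambda>i. exp (f i)) * mat_adjoint W"
proof (rule eq_matI)
  let ?A = "W * diag_of n f * mat_adjoint W" and ?E = "W * diag_of n (\<lambda>i. exp (f i)) * mat_adjoint W"
  have A: "?A \<in> carrier_mat n n" and E: "?E \<in> carrier_mat n n" using W by auto
  fix i j assume "i < dim_row ?E" "j < dim_col ?E"
  then have ij: "i < n" "j < n" using E by auto
  have "(\<lambda>k. \<Sum>a<n. W $$ (i,a) * (f a ^ k /\<^sub>R fact k) * cnj (W $$ (j,a))) sums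
      (\<Sum>a<n. W $$ (i,a) * exp (f a) * cnj (W $$ (j,a)))"
    by (intro sums_sum sums_mult sums_mult2 exp_converges)
  also have "(\<lambda>k. \<Sum>a<n. W $$ (i,a) * (f a ^ k /\<^sub>R fact k) * cnj (W $$ (j,a)))
      = (\<lambda>k. (?A ^\<^sub>m k) $$ (i,j) / of_nat (fact k))"
    unfolding spectral_power[OF W WW] index_spectral[OF W ij]
    by (auto simp: sum_divide_distrib scaleR_conv_of_real field_simps)
  finally have "(\<Sum>k. (?A ^\<^sub>m k) $$ (i,j) / of_nat (fact k)) = ?E $$ (i,j)"
    unfolding index_spectral[OF W ij] by (rule sums_unique[symmetric])
  then show "mat_exp ?A $$ (i,j) = ?E $$ (i,j)"
    using W ij by (simp add: mat_exp_def del: index_mult_mat(1))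
qed (use W in \<open>auto simp: mat_exp_def\<close>)

definition rexp :: "complex mat \<Rightarrow> real \<Rightarrow> complex mat" where
  "rexp H t = mat_exp ((- \<i> * complex_of_real t) \<cdot>\<^sub>m H)"

text \<open>The same \<open>W\<close> and d serve for all t, so both differentiation and
  measurability in t reduce to scalar phases.\<close>

lemma rexp_spectral:
  assumes H: "H \<in> carrier_mat n n" and h: "mat_adjoint H = H"
  obtains W d where "W \<in> carrier_mat n n" "mat_adjoint W * W = 1\<^sub>m n" "W * mat_adjoint W = 1\<^sub>m n"
    "H = W * diag_of n (\<lambda>i. complex_of_real (d i)) * mat_adjoint W"
    "\<And>t. rexp H t = W * diag_of n (\<lambda>i. exp (- \<i> * complex_of_real t * complex_of_real (d i))) * mat_adjoint W"
proof -
  obtain W d where W: "W \<in> carrier_mat n n" "mat_adjoint W * W = 1\<^sub>m n" "W * mat_adjoint W = 1\<^sub>m n"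
    and HW: "H = W * diag_of n (\<lambda>i. complex_of_real (d i)) * mat_adjoint W"
    using hermitian_spectral_decomposition[OF H h] by metis
  have "z \<cdot>\<^sub>m H = W * diag_of n (\<lambda>i. z * complex_of_real (d i)) * mat_adjoint W" for z
  proof (rule eq_matI)
    fix i j assume "i < dim_row (W * diag_of n (\<lambda>i. z * complex_of_real (d i)) * mat_adjoint W)"
      "j < dim_col (W * diag_of n (\<lambda>i. z * complex_of_real (d i)) * mat_adjoint W)"
    then have ij: "i < n" "j < n" using W by auto
    have "(z \<cdot>\<^sub>m H) $$ (i,j) = z * H $$ (i,j)"
      using H ij by simp
    also have "H $$ (i,j) = (W * diag_of n (\<lambda>i. complex_of_real (d i)) * mat_adjoint W) $$ (i,j)"
      using HW by (rule arg_cong)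
    finally show "(z \<cdot>\<^sub>m H) $$ (i,j) = (W * diag_of n (\<lambda>i. z * complex_of_real (d i)) * mat_adjoint W) $$ (i,j)"
      unfolding index_spectral[OF W(1) ij] by (simp add: sum_distrib_left mult_ac)
  qed (use H W in auto)
  then have "rexp H t = W * diag_of n (\<lambda>i. exp (- \<i> * complex_of_real t * complex_of_real (d i))) * mat_adjoint W" for t
    unfolding rexp_def by (simp only: mat_exp_spectral[OF W])
  then show ?thesis using that W HW by blast
qed

lemma rexp_carrier [simp]: "H \<in> carrier_mat n n \<Longrightarrow> rexp H t \<in> carrier_mat n n"
  unfolding rexp_def mat_exp_def by auto

lemma rexp_unitary:
  assumes H: "H \<in> carrier_mat n n" and h: "mat_adjoint H = H"
  shows "mat_adjoint (rexp H t) * rexp H t = 1\<^sub>m n" "rexp H t * mat_adjoint (rexp H t) = 1\<^sub>m n"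
proof -
  obtain W d where W: "W \<in> carrier_mat n n" "mat_adjoint W * W = 1\<^sub>m n" "W * mat_adjoint W = 1\<^sub>m n"
    and E: "\<And>t. rexp H t = W * diag_of n (\<lambda>i. exp (- \<i> * complex_of_real t * complex_of_real (d i))) * mat_adjoint W"
    using rexp_spectral[OF H h] by metis
  have "mat_adjoint (rexp H t) = W * diag_of n (\<lambda>i. exp (\<i> * complex_of_real t * complex_of_real (d i))) * mat_adjoint W"
    unfolding E using W
    by (simp add: mat_adjoint_mult[of _ n n _ n] mat_adjoint_diag_of exp_cnj assoc_mult_mat[of _ n n _ n _ n])
  then show "mat_adjoint (rexp H t) * rexp H t = 1\<^sub>m n"
    unfolding E by (simp add: spectral_mult[OF W(1,2)] exp_add[symmetric] spectral_one[OF W(1,3)])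
  then show "rexp H t * mat_adjoint (rexp H t) = 1\<^sub>m n"
    using mat_mult_left_right_inverse[of "mat_adjoint (rexp H t)" n "rexp H t"] H by auto
qed

section \<open>Differentiating the circuit in the Heisenberg picture\<close>

text \<open>The type of matrices does not fix their size, so the derivative is taken entry by entry
  and the carrier conditions travel with it, for all s, because products are expanded into sums at
  every s.\<close>

definition has_mat_deriv :: "nat \<Rightarrow> (real \<Rightarrow> complex mat) \<Rightarrow> complex mat \<Rightarrow> real \<Rightarrow> bool" where
  "has_mat_deriv n X X' t \<longleftrightarrow> (\<forall>s. X s \<in> carrier_mat n n) \<and> X' \<in> carrier_mat n n \<and>
     (\<forall>i<n. \<forall>j<n. ((\<lambda>s. X s $$ (i,j)) has_vector_derivative X' $$ (i,j)) (at t))"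

lemma has_mat_deriv_carrier: "has_mat_deriv n X X' t \<Longrightarrow> X s \<in> carrier_mat n n" "has_mat_deriv n X X' t \<Longrightarrow> X' \<in> carrier_mat n n"
  by (auto simp: has_mat_deriv_def)

lemma has_mat_deriv_const: "A \<in> carrier_mat n n \<Longrightarrow> has_mat_deriv n (\<lambda>_. A) (0\<^sub>m n n) t"
  by (auto simp: has_mat_deriv_def)

lemma has_mat_deriv_mult:
  assumes X: "has_mat_deriv n X X' t" and Y: "has_mat_deriv n Y Y' t"
  shows "has_mat_deriv n (\<lambda>s. X s * Y s) (X t * Y' + X' * Y t) t"
  unfolding has_mat_deriv_def
proof (intro conjI allI impI)
  note c = has_mat_deriv_carrier[OF X] has_mat_deriv_carrier[OF Y]
  show "X s * Y s \<in> carrier_mat n n" for s using c by simp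
  show "X t * Y' + X' * Y t \<in> carrier_mat n n" using c by simp
  fix i j assume ij: "i < n" "j < n"
  have "((\<lambda>s. \<Sum>l<n. X s $$ (i,l) * Y s $$ (l,j)) has_vector_derivative
     (\<Sum>l<n. X t $$ (i,l) * Y' $$ (l,j) + X' $$ (i,l) * Y t $$ (l,j))) (at t)"
    using X Y ij unfolding has_mat_deriv_def
    by (intro has_vector_derivative_sum has_vector_derivative_mult) auto
  then show "((\<lambda>s. (X s * Y s) $$ (i,j)) has_vector_derivative (X t * Y' + X' * Y t) $$ (i,j)) (at t)"
    using c ij by (simp add: index_mult_mat_sum[of _ n n _ n] sum.distrib carrier_matD[of _ n n] del: index_mult_mat(1))
qed

lemma has_mat_deriv_minus:
  assumes "has_mat_deriv n X X' t" "has_mat_deriv n Y Y' t"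
  shows "has_mat_deriv n (\<lambda>s. X s - Y s) (X' - Y') t"
  using assms unfolding has_mat_deriv_def by (auto simp: minus_carrier_mat carrier_matD[of _ n n] intro!: has_vector_derivative_diff)

lemma has_mat_deriv_smult:
  assumes "has_mat_deriv n X X' t"
  shows "has_mat_deriv n (\<lambda>s. c \<cdot>\<^sub>m X s) (c \<cdot>\<^sub>m X') t"
  using assms unfolding has_mat_deriv_def by (auto simp: carrier_matD[of _ n n] intro!: has_vector_derivative_mult_right)

lemma has_mat_deriv_adjoint:
  assumes "has_mat_deriv n X X' t"
  shows "has_mat_deriv n (\<lambda>s. mat_adjoint (X s)) (mat_adjoint X') t"
  unfolding has_mat_deriv_def
proof (intro conjI allI impI)
  fix i j assume ij: "i < n" "j < n"
  have "((\<lambda>s. cnj (X s $$ (j,i))) has_vector_derivative cnj (X' $$ (j,i))) (at t)"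
    using assms ij unfolding has_mat_deriv_def by (intro has_vector_derivative_cnj) auto
  then show "((\<lambda>s. mat_adjoint (X s) $$ (i,j)) has_vector_derivative mat_adjoint X' $$ (i,j)) (at t)"
    using has_mat_deriv_carrier[OF assms] ij by (simp add: index_mat_adjoint carrier_matD[of _ n n])
qed (use has_mat_deriv_carrier[OF assms] in auto)

lemma has_mat_deriv_mult_left:
  assumes A: "A \<in> carrier_mat n n" and X: "has_mat_deriv n X X' t"
  shows "has_mat_deriv n (\<lambda>s. A * X s) (A * X') t"
  using has_mat_deriv_mult[OF has_mat_deriv_const[OF A] X] A has_mat_deriv_carrier(1)[OF X, of t] has_mat_deriv_carrier(2)[OF X] by simp

lemma has_mat_deriv_mult_right:
  assumes A: "A \<in> carrier_mat n n" and X: "has_mat_deriv n X X' t"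
  shows "has_mat_deriv n (\<lambda>s. X s * A) (X' * A) t"
  using has_mat_deriv_mult[OF X has_mat_deriv_const[OF A]] A has_mat_deriv_carrier(1)[OF X, of t] has_mat_deriv_carrier(2)[OF X] by simp

lemma has_mat_deriv_comm_i:
  assumes "H \<in> carrier_mat n n" "has_mat_deriv n X X' t"
  shows "has_mat_deriv n (\<lambda>s. comm_i H (X s)) (comm_i H X') t"
  unfolding comm_i_def using assms by (intro has_mat_deriv_smult has_mat_deriv_minus has_mat_deriv_mult_left has_mat_deriv_mult_right)

lemma has_mat_deriv_rexp:
  assumes H: "H \<in> carrier_mat n n" and h: "mat_adjoint H = H"
  shows "has_mat_deriv n (rexp H) ((- \<i>) \<cdot>\<^sub>m (rexp H t * H)) t"
  unfolding has_mat_deriv_def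
proof (intro conjI allI impI)
  fix i j assume ij: "i < n" "j < n"
  obtain W d where W: "W \<in> carrier_mat n n" "mat_adjoint W * W = 1\<^sub>m n" "W * mat_adjoint W = 1\<^sub>m n"
    and HW: "H = W * diag_of n (\<lambda>i. complex_of_real (d i)) * mat_adjoint W"
    and E: "\<And>t. rexp H t = W * diag_of n (\<lambda>i. exp (- \<i> * complex_of_real t * complex_of_real (d i))) * mat_adjoint W"
    using rexp_spectral[OF H h] by metis
  have "rexp H t * H = rexp H t * (W * diag_of n (\<lambda>i. complex_of_real (d i)) * mat_adjoint W)"
    using HW by (rule arg_cong)
  then have EH: "rexp H t * H = W * diag_of n (\<lambda>i. exp (- \<i> * complex_of_real t * complex_of_real (d i)) * complex_of_real (d i)) * mat_adjoint W"
    unfolding E spectral_mult[OF W(1,2)] .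
  have "((\<lambda>s. exp (- \<i> * complex_of_real s * complex_of_real x)) has_vector_derivative
      - \<i> * (exp (- \<i> * complex_of_real t * complex_of_real x) * complex_of_real x)) (at t)" for x
    by (rule has_vector_derivative_real_field, (rule derivative_eq_intros refl | simp)+)
  then have "((\<lambda>s. \<Sum>a<n. W $$ (i,a) * exp (- \<i> * complex_of_real s * complex_of_real (d a)) * cnj (W $$ (j,a)))
     has_vector_derivative (\<Sum>a<n. W $$ (i,a) * (- \<i> * (exp (- \<i> * complex_of_real t * complex_of_real (d a)) * complex_of_real (d a))) * cnj (W $$ (j,a)))) (at t)"
    by (intro has_vector_derivative_sum has_vector_derivative_mult_left has_vector_derivative_mult_right)
  also have "(\<Sum>a<n. W $$ (i,a) * (- \<i> * (exp (- \<i> * complex_of_real t * complex_of_real (d a)) * complex_of_real (d a))) * cnj (W $$ (j,a)))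
      = - \<i> * (rexp H t * H) $$ (i,j)"
    unfolding EH index_spectral[OF W(1) ij] by (simp add: sum_distrib_left mult_ac sum_negf)
  also have "\<dots> = ((- \<i>) \<cdot>\<^sub>m (rexp H t * H)) $$ (i,j)"
    using H ij rexp_carrier[OF H, of t] by (simp add: carrier_matD[of _ n n] del: index_mult_mat(1))
  finally show "((\<lambda>s. rexp H s $$ (i,j)) has_vector_derivative ((- \<i>) \<cdot>\<^sub>m (rexp H t * H)) $$ (i,j)) (at t)"
    unfolding E index_spectral[OF W(1) ij] .
qed (use H in auto)

text \<open>The Heisenberg action of one gate: conjugation by \<open>V * rexp H t\<close>, bracketed
  so that the rotation is outermost.\<close>

definition gate :: "complex mat \<Rightarrow> complex mat \<Rightarrow> real \<Rightarrow> complex mat \<Rightarrow> complex mat" where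
  "gate V H t A = mat_adjoint (rexp H t) * (mat_adjoint V * A * V) * rexp H t"

lemma gate_carrier [simp]:
  "V \<in> carrier_mat n n \<Longrightarrow> H \<in> carrier_mat n n \<Longrightarrow> A \<in> carrier_mat n n \<Longrightarrow> gate V H t A \<in> carrier_mat n n"
  by (simp add: gate_def)

lemma gate_add:
  assumes "V \<in> carrier_mat n n" "H \<in> carrier_mat n n" "A \<in> carrier_mat n n" "B \<in> carrier_mat n n"
  shows "gate V H t (A + B) = gate V H t A + gate V H t B"
  unfolding gate_def using assms rexp_carrier[OF assms(2), of t]
  by (simp add: mult_add_distrib_mat[of _ n n _ n] add_mult_distrib_mat[of _ n n _ _ n])

lemma comm_i_add:
  assumes "H \<in> carrier_mat n n" "A \<in> carrier_mat n n" "B \<in> carrier_mat n n"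
  shows "comm_i H (A + B) = comm_i H A + comm_i H B"
  unfolding comm_i_def using assms
  by (simp add: mult_add_distrib_mat[of _ n n _ n] add_mult_distrib_mat[of _ n n _ _ n])
    (rule eq_matI; auto simp: algebra_simps simp del: index_mult_mat(1))

lemma has_mat_deriv_gate_const:
  assumes V: "V \<in> carrier_mat n n" and H: "H \<in> carrier_mat n n" and A: "has_mat_deriv n A A' t"
  shows "has_mat_deriv n (\<lambda>s. gate V H u (A s)) (gate V H u A') t"
  unfolding gate_def using assms by (intro has_mat_deriv_mult_left has_mat_deriv_mult_right) auto

text \<open>Writing the derivative of the rotation E as -i E H puts H outermost, so the two
  product-rule terms from E and its adjoint combine into the commutator of H with the whole
  pulled-back observable. The remaining term comes from A alone.\<close>

lemma has_mat_deriv_gate: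
  assumes V: "V \<in> carrier_mat n n" and H: "H \<in> carrier_mat n n" and h: "mat_adjoint H = H"
    and A: "has_mat_deriv n A A' t"
  shows "has_mat_deriv n (\<lambda>s. gate V H s (A s)) (gate V H t A' + comm_i H (gate V H t (A t))) t"
proof -
  define E where "E = rexp H t"
  define Y where "Y s = mat_adjoint V * A s * V" for s
  define Y' where "Y' = mat_adjoint V * A' * V"
  have E: "E \<in> carrier_mat n n" using H by (simp add: E_def)
  have Y: "has_mat_deriv n Y Y' t"
    unfolding Y_def Y'_def using V A by (intro has_mat_deriv_mult_left has_mat_deriv_mult_right) auto
  note cY = has_mat_deriv_carrier[OF Y]
  define dE where "dE = (- \<i>) \<cdot>\<^sub>m (E * H)"
  have dE: "dE \<in> carrier_mat n n" using E H by (simp add: dE_def)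
  have mE: "has_mat_deriv n (rexp H) dE t" using has_mat_deriv_rexp[OF H h] by (simp add: E_def dE_def)
  have adj: "mat_adjoint dE = \<i> \<cdot>\<^sub>m (H * mat_adjoint E)"
  proof -
    have "mat_adjoint ((- \<i>) \<cdot>\<^sub>m (E * H)) = \<i> \<cdot>\<^sub>m mat_adjoint (E * H)"
      using E H by (intro eq_matI) (auto simp: index_mat_adjoint simp del: index_mult_mat(1))
    then show ?thesis unfolding dE_def mat_adjoint_mult[OF E H] h .
  qed
  have "has_mat_deriv n (\<lambda>s. mat_adjoint (rexp H s) * Y s * rexp H s)
      (mat_adjoint E * Y t * dE + (mat_adjoint E * Y' + mat_adjoint dE * Y t) * E) t"
    using has_mat_deriv_mult[OF has_mat_deriv_mult[OF has_mat_deriv_adjoint[OF mE] Y] mE] by (simp add: E_def)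
  also have "mat_adjoint E * Y t * dE + (mat_adjoint E * Y' + mat_adjoint dE * Y t) * E
     = mat_adjoint E * Y' * E + comm_i H (mat_adjoint E * Y t * E)"
  proof -
    have "mat_adjoint E * Y t * dE = (- \<i>) \<cdot>\<^sub>m (mat_adjoint E * Y t * E * H)"
      unfolding dE_def using E H cY
      by (simp add: mult_smult_distrib[of _ n n _ n] assoc_mult_mat[of _ n n _ n _ n])
    moreover have "(mat_adjoint E * Y' + mat_adjoint dE * Y t) * E
        = mat_adjoint E * Y' * E + \<i> \<cdot>\<^sub>m (H * (mat_adjoint E * Y t * E))"
      unfolding adj using E H cY
      by (simp add: add_mult_distrib_mat[of _ n n _ _ n] mult_smult_assoc_mat[of _ n n _ n] assoc_mult_mat[of _ n n _ n _ n])
    ultimately show ?thesis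
      unfolding comm_i_def using E H cY
      by (intro eq_matI) (auto simp: algebra_simps simp del: index_mult_mat(1))
  qed
  finally show ?thesis unfolding gate_def Y_def Y'_def E_def .
qed

text \<open>The observable pulled back through the gates \<open>ls\<close>, with \<open>k l\<close> commutators \<open>X \<mapsto> i [H\<^sub>l, X]\<close>
  applied after gate \<open>l\<close>. Differentiating in \<open>\<theta>\<^sub>q\<close> raises \<open>k l\<close> by one for one gate \<open>l\<close> with
  \<open>S l = q\<close>, so the family is closed under partial derivatives.\<close>

fun heisenberg :: "(nat \<Rightarrow> complex mat) \<Rightarrow> (nat \<Rightarrow> complex mat) \<Rightarrow> (nat \<Rightarrow> nat) \<Rightarrow> (nat \<Rightarrow> nat) \<Rightarrow> nat list
    \<Rightarrow> (nat \<Rightarrow> real) \<Rightarrow> complex mat \<Rightarrow> complex mat" where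
  "heisenberg V H S k [] \<theta> A = A"
| "heisenberg V H S k (l # ls) \<theta> A = heisenberg V H S k ls \<theta> ((comm_i (H l) ^^ k l) (gate (V l) (H l) (\<theta> (S l)) A))"

lemma heisenberg_cong_param:
  "(\<And>l. l \<in> set ls \<Longrightarrow> \<theta> (S l) = \<theta>' (S l)) \<Longrightarrow> heisenberg V H S k ls \<theta> A = heisenberg V H S k ls \<theta>' A"
  by (induction ls arbitrary: A) auto

lemma heisenberg_cong_order:
  "(\<And>l. l \<in> set ls \<Longrightarrow> k l = k' l) \<Longrightarrow> heisenberg V H S k ls \<theta> A = heisenberg V H S k' ls \<theta> A"
  by (induction ls arbitrary: A) auto

lemma comm_i_power_carrier [simp]:
  "H \<in> carrier_mat n n \<Longrightarrow> A \<in> carrier_mat n n \<Longrightarrow> (comm_i H ^^ j) A \<in> carrier_mat n n"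
  by (induction j) auto

lemma comm_i_power_add:
  "H \<in> carrier_mat n n \<Longrightarrow> A \<in> carrier_mat n n \<Longrightarrow> B \<in> carrier_mat n n \<Longrightarrow>
    (comm_i H ^^ j) (A + B) = (comm_i H ^^ j) A + (comm_i H ^^ j) B"
  by (induction j) (auto simp: comm_i_add[of _ n])

lemma has_mat_deriv_comm_i_power:
  "H \<in> carrier_mat n n \<Longrightarrow> has_mat_deriv n X X' t \<Longrightarrow> has_mat_deriv n (\<lambda>s. (comm_i H ^^ j) (X s)) ((comm_i H ^^ j) X') t"
  by (induction j) (auto intro: has_mat_deriv_comm_i)

lemma op_bounded_by_comm_i_power:
  assumes H: "H \<in> carrier_mat n n" and h: "mat_adjoint H = H" and n: "n > 0"
    and X: "X \<in> carrier_mat n n" and b: "op_bounded_by X b" "0 \<le> b"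
  shows "op_bounded_by ((comm_i H ^^ j) X) ((lam_max H - lam_min H) ^ j * b)"
proof (induction j)
  case (Suc j)
  have "op_bounded_by (comm_i H ((comm_i H ^^ j) X)) ((lam_max H - lam_min H) * ((lam_max H - lam_min H) ^ j * b))"
    using H h n X b Suc lam_min_le_lam_max[OF H n] by (intro op_bounded_by_comm_i[of _ n]) auto
  then show ?case by (simp add: mult.assoc)
qed (use b in simp)

lemma has_vector_derivative_mtrace:
  assumes R: "R \<in> carrier_mat n n" and X: "has_mat_deriv n X X' t"
  shows "((\<lambda>s. mtrace (R * X s)) has_vector_derivative mtrace (R * X')) (at t)"
proof -
  have "has_mat_deriv n (\<lambda>s. R * X s) (R * X') t" by (rule has_mat_deriv_mult_left[OF R X])
  then have "((\<lambda>s. \<Sum>i<n. (R * X s) $$ (i,i)) has_vector_derivative (\<Sum>i<n. (R * X') $$ (i,i))) (at t)"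
    unfolding has_mat_deriv_def by (intro has_vector_derivative_sum) auto
  then show ?thesis using R unfolding mtrace_def by (simp del: index_mult_mat(1))
qed

lemma mtrace_mult_add:
  assumes "R \<in> carrier_mat n n" "A \<in> carrier_mat n n" "B \<in> carrier_mat n n"
  shows "mtrace (R * (A + B)) = mtrace (R * A) + mtrace (R * B)"
  using assms unfolding mtrace_def mult_add_distrib_mat[OF assms]
  by (simp add: sum.distrib del: index_mult_mat(1))

text \<open>Here n is the matrix dimension; it is instantiated with 2 to the number of
  qubits.\<close>

locale circuit =
  fixes n :: nat and V H :: "nat \<Rightarrow> complex mat" and S :: "nat \<Rightarrow> nat" and M :: nat
  assumes n_pos: "0 < n"
    and V: "\<And>l. l < M \<Longrightarrow> V l \<in> carrier_mat n n" and H: "\<And>l. l < M \<Longrightarrow> H l \<in> carrier_mat n n"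
    and V_unitary: "\<And>l. l < M \<Longrightarrow> mat_adjoint (V l) * V l = 1\<^sub>m n"
    and V_unitary': "\<And>l. l < M \<Longrightarrow> V l * mat_adjoint (V l) = 1\<^sub>m n"
    and H_herm: "\<And>l. l < M \<Longrightarrow> mat_adjoint (H l) = H l"
begin

abbreviation "width l \<equiv> lam_max (H l) - lam_min (H l)"

lemma width_nonneg: "l < M \<Longrightarrow> 0 \<le> width l"
  using lam_min_le_lam_max[OF H n_pos] by simp

lemma heisenberg_carrier:
  "set ls \<subseteq> {..<M} \<Longrightarrow> A \<in> carrier_mat n n \<Longrightarrow> heisenberg V H S k ls \<theta> A \<in> carrier_mat n n"
  by (induction ls arbitrary: A) (auto simp: V H)

lemma heisenberg_add:
  "set ls \<subseteq> {..<M} \<Longrightarrow> A \<in> carrier_mat n n \<Longrightarrow> B \<in> carrier_mat n n \<Longrightarrow>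
    heisenberg V H S k ls \<theta> (A + B) = heisenberg V H S k ls \<theta> A + heisenberg V H S k ls \<theta> B"
  by (induction ls arbitrary: A B) (auto simp: V H gate_add[of _ n] comm_i_power_add[of _ n])

text \<open>Additivity gives h(0) = h(0) + h(0); taking traces lets the cancellation happen in the
  complex numbers. It disposes of gates not driven by the differentiated parameter and of the
  derivative of a constant observable.\<close>

lemma mtrace_heisenberg_zero:
  assumes "R \<in> carrier_mat n n" "set ls \<subseteq> {..<M}"
  shows "mtrace (R * heisenberg V H S k ls \<theta> (0\<^sub>m n n)) = 0"
proof -
  let ?h = "heisenberg V H S k ls \<theta>"
  have "?h (0\<^sub>m n n) = ?h (0\<^sub>m n n) + ?h (0\<^sub>m n n)"
    using heisenberg_add[OF assms(2) zero_carrier_mat zero_carrier_mat] by simp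
  then have "mtrace (R * ?h (0\<^sub>m n n)) = mtrace (R * ?h (0\<^sub>m n n)) + mtrace (R * ?h (0\<^sub>m n n))"
    using mtrace_mult_add[OF assms(1) heisenberg_carrier[OF assms(2)] heisenberg_carrier[OF assms(2)]] by (metis zero_carrier_mat)
  then show ?thesis by simp
qed

lemma op_bounded_by_gate:
  assumes l: "l < M" and A: "A \<in> carrier_mat n n" and b: "op_bounded_by A b" "0 \<le> b"
  shows "op_bounded_by (gate (V l) (H l) t A) b"
proof -
  have "op_bounded_by (gate (V l) (H l) t A) (1 * (1 * b * 1) * 1)"
    unfolding gate_def using V[OF l] H[OF l] V_unitary[OF l] V_unitary'[OF l] A b
      rexp_unitary[OF H[OF l] H_herm[OF l]]
    by (intro op_bounded_by_mult[of _ n n _ n] op_bounded_by_isometry[of _ n]) auto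
  then show ?thesis by simp
qed

lemma op_bounded_by_heisenberg:
  "set ls \<subseteq> {..<M} \<Longrightarrow> A \<in> carrier_mat n n \<Longrightarrow> op_bounded_by A b \<Longrightarrow> 0 \<le> b \<Longrightarrow>
    op_bounded_by (heisenberg V H S k ls \<theta> A) (b * (\<Prod>l\<leftarrow>ls. width l ^ k l))"
proof (induction ls arbitrary: A b)
  case (Cons l ls)
  then have l: "l < M" by auto
  let ?B = "(comm_i (H l) ^^ k l) (gate (V l) (H l) (\<theta> (S l)) A)"
  have "op_bounded_by ?B (width l ^ k l * b)"
    using l Cons.prems by (intro op_bounded_by_comm_i_power[of _ n] op_bounded_by_gate) (auto simp: H V H_herm n_pos)
  then have "op_bounded_by (heisenberg V H S k ls \<theta> ?B) (width l ^ k l * b * (\<Prod>l\<leftarrow>ls. width l ^ k l))"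
    using l Cons.prems width_nonneg[OF l] by (intro Cons.IH mult_nonneg_nonneg zero_le_power) (auto simp: H V)
  then show ?case by (simp add: mult_ac)
qed simp

text \<open>The observable itself must be allowed to depend on s: once the first gate is peeled off,
  the remaining gates act on an argument that already contains the parameter. Distinctness of the
  list ensures that raising k at l affects a single gate.\<close>

lemma heisenberg_deriv:
  assumes R: "R \<in> carrier_mat n n"
  shows "set ls \<subseteq> {..<M} \<Longrightarrow> distinct ls \<Longrightarrow> has_mat_deriv n A A' t \<Longrightarrow>
    ((\<lambda>s. mtrace (R * heisenberg V H S k ls (\<theta>(q := s)) (A s))) has_vector_derivative
      mtrace (R * heisenberg V H S k ls (\<theta>(q := t)) A') +
      (\<Sum>l | l \<in> set ls \<and> S l = q. mtrace (R * heisenberg V H S (k(l := Suc (k l))) ls (\<theta>(q := t)) (A t)))) (at t)"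
proof (induction ls arbitrary: A A')
  case Nil
  then show ?case using has_vector_derivative_mtrace[OF R] by simp
next
  case (Cons l ls)
  then have l: "l < M" and ls: "set ls \<subseteq> {..<M}" "distinct ls" "l \<notin> set ls" by auto
  note cA = has_mat_deriv_carrier[OF Cons.prems(3)]
  let ?\<theta> = "\<lambda>s. \<theta>(q := s)"
  define G where "G s = gate (V l) (H l) (?\<theta> s (S l))" for s
  define X where "X s = (comm_i (H l) ^^ k l) (G s (A s))" for s
  define X1 where "X1 = (comm_i (H l) ^^ k l) (G t A')"
  define X2 where "X2 = (comm_i (H l) ^^ Suc (k l)) (G t (A t))"
  \<comment> \<open>The contribution of gate l. Taking the zero matrix when its parameter is not q
    gives both cases the common derivative X1 + Z.\<close>
  define Z where "Z = (if S l = q then X2 else 0\<^sub>m n n)"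
  have c: "X1 \<in> carrier_mat n n" "X2 \<in> carrier_mat n n" "Z \<in> carrier_mat n n" "G t A' \<in> carrier_mat n n"
    "G t (A t) \<in> carrier_mat n n"
    using cA V[OF l] H[OF l] by (auto simp: X1_def X2_def Z_def G_def)
  have X: "has_mat_deriv n X (X1 + Z) t"
  proof (cases "S l = q")
    case True
    have "has_mat_deriv n (\<lambda>s. G s (A s)) (G t A' + comm_i (H l) (G t (A t))) t"
      unfolding G_def using True has_mat_deriv_gate[OF V[OF l] H[OF l] H_herm[OF l] Cons.prems(3)] by simp
    from has_mat_deriv_comm_i_power[OF H[OF l] this, of "k l"] show ?thesis
      using True c H[OF l] unfolding X_def X1_def X2_def Z_def
      by (simp add: comm_i_power_add[of _ n] funpow_swap1)
  next
    case False
    then have "has_mat_deriv n (\<lambda>s. G s (A s)) (G t A') t"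
      unfolding G_def using has_mat_deriv_gate_const[OF V[OF l] H[OF l] Cons.prems(3)] by simp
    from has_mat_deriv_comm_i_power[OF H[OF l] this, of "k l"] show ?thesis
      using False c H[OF l] unfolding X_def X1_def Z_def by simp
  qed
  let ?h = "\<lambda>k ls B. mtrace (R * heisenberg V H S k ls (?\<theta> t) B)"
  have eq1: "?h (k(l' := Suc (k l'))) ls (X t) = ?h (k(l' := Suc (k l'))) (l # ls) (A t)" if "l' \<in> set ls" for l'
    using that ls(3) by (auto simp: X_def G_def)
  have sum_eq: "?h k ls (X1 + Z) + (\<Sum>l' | l' \<in> set ls \<and> S l' = q. ?h (k(l' := Suc (k l'))) ls (X t))
     = ?h k (l # ls) A' + (\<Sum>l' | l' \<in> set (l # ls) \<and> S l' = q. ?h (k(l' := Suc (k l'))) (l # ls) (A t))"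
  proof -
    have "?h k ls (X1 + Z) = ?h k ls X1 + ?h k ls Z"
      using ls c R by (simp add: heisenberg_add heisenberg_carrier mtrace_mult_add[of _ n])
    moreover have "?h k ls X1 = ?h k (l # ls) A'" by (simp add: X1_def G_def)
    moreover have "(\<Sum>l' | l' \<in> set ls \<and> S l' = q. ?h (k(l' := Suc (k l'))) ls (X t))
       = (\<Sum>l' | l' \<in> set ls \<and> S l' = q. ?h (k(l' := Suc (k l'))) (l # ls) (A t))"
      by (intro sum.cong) (auto simp: eq1 simp del: heisenberg.simps)
    moreover have "(\<Sum>l' | l' \<in> set (l # ls) \<and> S l' = q. ?h (k(l' := Suc (k l'))) (l # ls) (A t))
       = ?h k ls Z + (\<Sum>l' | l' \<in> set ls \<and> S l' = q. ?h (k(l' := Suc (k l'))) (l # ls) (A t))"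
    proof (cases "S l = q")
      case True
      have "heisenberg V H S (k(l := Suc (k l))) ls (?\<theta> t) X2 = heisenberg V H S k ls (?\<theta> t) X2"
        using ls by (intro heisenberg_cong_order) auto
      moreover have "{l'. l' \<in> set (l # ls) \<and> S l' = q} = insert l {l'. l' \<in> set ls \<and> S l' = q}"
        using True by auto
      ultimately show ?thesis
        using True ls(3) by (simp add: Z_def X2_def G_def)
    next
      case False
      then have "?h k ls Z = 0" using mtrace_heisenberg_zero[OF R ls(1)] by (simp add: Z_def)
      moreover have "{l'. l' \<in> set (l # ls) \<and> S l' = q} = {l'. l' \<in> set ls \<and> S l' = q}"
        using False by auto
      ultimately show ?thesis by simp
    qed
    ultimately show ?thesis by simp
  qed
  show ?case
    using Cons.IH[OF ls(1,2) X, unfolded sum_eq] unfolding X_def G_def heisenberg.simps .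
qed

text \<open>As for derivatives, the property is entrywise (\<open>mm\<close>) and preserved by every
  operation that builds \<open>heisenberg\<close>; the observable varies with x for the sake of the
  induction.\<close>

lemma heisenberg_measurable:
  fixes N :: "'x measure"
  assumes "set ls \<subseteq> {..<M}" "\<And>l. l \<in> set ls \<Longrightarrow> (\<lambda>x. g x (S l)) \<in> borel_measurable N"
    and "\<And>x. A x \<in> carrier_mat n n" "\<And>i j. i < n \<Longrightarrow> j < n \<Longrightarrow> (\<lambda>x. A x $$ (i,j)) \<in> borel_measurable N"
    and "i < n" "j < n"
  shows "(\<lambda>x. heisenberg V H S k ls (g x) (A x) $$ (i,j)) \<in> borel_measurable N"
proof -
  define mm where "mm X \<longleftrightarrow> (\<forall>x. X x \<in> carrier_mat n n) \<and> (\<forall>i<n. \<forall>j<n. (\<lambda>x. X x $$ (i,j)) \<in> borel_measurable N)"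
    for X :: "'x \<Rightarrow> complex mat"
  have const: "mm (\<lambda>_. B)" if "B \<in> carrier_mat n n" for B using that by (simp add: mm_def)
  have mult: "mm (\<lambda>x. X x * Y x)" if "mm X" "mm Y" for X Y
    unfolding mm_def
  proof (intro conjI allI impI)
    fix i j assume ij: "i < n" "j < n"
    have "(\<lambda>x. \<Sum>l<n. X x $$ (i,l) * Y x $$ (l,j)) \<in> borel_measurable N"
      using that ij unfolding mm_def by (intro borel_measurable_sum borel_measurable_times) auto
    moreover have "(X x * Y x) $$ (i,j) = (\<Sum>l<n. X x $$ (i,l) * Y x $$ (l,j))" for x
      using that ij unfolding mm_def by (intro index_mult_mat_sum) auto
    ultimately show "(\<lambda>x. (X x * Y x) $$ (i,j)) \<in> borel_measurable N" by (simp del: index_mult_mat(1))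
  qed (use that in \<open>auto simp: mm_def\<close>)
  have comm: "mm (\<lambda>x. comm_i B (X x))" if B: "B \<in> carrier_mat n n" and X: "mm X" for B X
  proof -
    have "mm (\<lambda>x. B * X x)" "mm (\<lambda>x. X x * B)" using mult const B X by auto
    moreover have "comm_i B (X x) $$ (i,j) = \<i> * ((B * X x) $$ (i,j) - (X x * B) $$ (i,j))" if "i < n" "j < n" for i j x
      using that B X unfolding comm_i_def mm_def by (simp add: carrier_matD[of _ n n] del: index_mult_mat(1))
    ultimately show ?thesis using B X unfolding mm_def
      by (auto simp del: index_mult_mat(1) intro!: borel_measurable_times borel_measurable_diff)
  qed
  have comm_pow: "mm (\<lambda>x. (comm_i B ^^ j) (X x))" if "B \<in> carrier_mat n n" "mm X" for B X j
    using that by (induction j) (auto intro: comm)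
  have adj: "mm (\<lambda>x. mat_adjoint (X x))" if X: "mm X" for X
  proof -
    have "mat_adjoint (X x) $$ (i,j) = cnj (X x $$ (j,i))" if "i < n" "j < n" for i j x
      using that X unfolding mm_def by (intro index_mat_adjoint) (auto simp: carrier_matD[of _ n n])
    moreover have "(\<lambda>x. cnj (X x $$ (j,i))) \<in> borel_measurable N" if "i < n" "j < n" for i j
      using that X unfolding mm_def
      by (intro measurable_compose[OF _ borel_measurable_continuous_onI[of cnj]] continuous_intros) auto
    ultimately show ?thesis using X unfolding mm_def by auto
  qed
  have rexp: "mm (\<lambda>x. rexp B (f x))"
    if B: "B \<in> carrier_mat n n" "mat_adjoint B = B" and f: "f \<in> borel_measurable N" for B f
  proof -
    obtain W d where W: "W \<in> carrier_mat n n"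
      and E: "\<And>t. rexp B t = W * diag_of n (\<lambda>i. exp (- \<i> * complex_of_real t * complex_of_real (d i))) * mat_adjoint W"
      using rexp_spectral[OF B] by metis
    have m: "(\<lambda>x. exp (- \<i> * complex_of_real (f x) * complex_of_real c)) \<in> borel_measurable N" for c
      by (rule measurable_compose[OF f borel_measurable_continuous_onI]) (intro continuous_intros)
    have "(\<lambda>x. rexp B (f x) $$ (i,j)) \<in> borel_measurable N" if ij: "i < n" "j < n" for i j
      unfolding E index_spectral[OF W ij] by (intro borel_measurable_sum borel_measurable_times m) auto
    then show ?thesis using B unfolding mm_def by auto
  qed
  have "mm A \<Longrightarrow> mm (\<lambda>x. heisenberg V H S k ls (g x) (A x))"
    using assms(1,2)
  proof (induction ls arbitrary: A)
    case (Cons l ls)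
    then have l: "l < M" by auto
    have "mm (\<lambda>x. (comm_i (H l) ^^ k l) (gate (V l) (H l) (g x (S l)) (A x)))"
      unfolding gate_def using l Cons.prems V[OF l] H[OF l] H_herm[OF l]
      by (intro comm_pow mult adj rexp const) auto
    then show ?case using Cons by auto
  qed simp
  then show ?thesis using assms by (auto simp: mm_def)
qed

lemma circ_carrier: "set ls \<subseteq> {..<M} \<Longrightarrow> circ n V H S \<theta> ls \<in> carrier_mat n n"
proof (induction ls)
  case (Cons l ls)
  then show ?case
    using V[of l] rexp_carrier[OF H, of l "\<theta> (S l)"] unfolding rexp_def by simp
qed simp

text \<open>The head of the list is the leftmost factor of the circuit and hence acts on the
  observable first; this fixes the direction in which \<open>heisenberg\<close> recurses.\<close>

lemma heisenberg_circ:
  "set ls \<subseteq> {..<M} \<Longrightarrow> A \<in> carrier_mat n n \<Longrightarrow>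
    mat_adjoint (circ n V H S \<theta> ls) * A * circ n V H S \<theta> ls = heisenberg V H S (\<lambda>_. 0) ls \<theta> A"
proof (induction ls arbitrary: A)
  case Nil
  then show ?case by (simp add: mat_adjoint_one)
next
  case (Cons l ls)
  then have l: "l < M" and ls: "set ls \<subseteq> {..<M}" by auto
  let ?E = "rexp (H l) (\<theta> (S l))" and ?C = "circ n V H S \<theta> ls"
  have c: "?E \<in> carrier_mat n n" "V l \<in> carrier_mat n n" "?C \<in> carrier_mat n n"
    using V[OF l] H[OF l] circ_carrier[OF ls] by auto
  have "mat_adjoint (circ n V H S \<theta> (l # ls)) * A * circ n V H S \<theta> (l # ls)
    = mat_adjoint (V l * ?E * ?C) * A * (V l * ?E * ?C)" by (simp add: rexp_def)
  also have "\<dots> = mat_adjoint ?C * gate (V l) (H l) (\<theta> (S l)) A * ?C"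
    using c Cons.prems(2) unfolding gate_def
    by (simp add: mat_adjoint_mult[of _ n n _ n] assoc_mult_mat[of _ n n _ n _ n])
  also have "\<dots> = heisenberg V H S (\<lambda>_. 0) ls \<theta> (gate (V l) (H l) (\<theta> (S l)) A)"
    using Cons V[OF l] H[OF l] by (intro Cons.IH) auto
  finally show ?case by simp
qed

end

section \<open>The variance bound\<close>

text \<open>\<open>loss_deriv V H S M \<rho> Ob qs (\<lambda>_. 0)\<close> is the partial derivative of the loss in the parameters
  listed in \<open>qs\<close>, the head being the last differentiation performed.\<close>

fun loss_deriv :: "(nat \<Rightarrow> complex mat) \<Rightarrow> (nat \<Rightarrow> complex mat) \<Rightarrow> (nat \<Rightarrow> nat) \<Rightarrow> nat \<Rightarrow> complex mat \<Rightarrow> complex mat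
    \<Rightarrow> nat list \<Rightarrow> (nat \<Rightarrow> nat) \<Rightarrow> (nat \<Rightarrow> real) \<Rightarrow> real" where
  "loss_deriv V H S M \<rho> Ob [] k \<theta> = Re (mtrace (\<rho> * heisenberg V H S k [0..<M] \<theta> Ob))"
| "loss_deriv V H S M \<rho> Ob (q # qs) k \<theta> =
     (\<Sum>l | l < M \<and> S l = q. loss_deriv V H S M \<rho> Ob qs (k(l := Suc (k l))) \<theta>)"

context circuit
begin

text \<open>Differentiating under the sum over gates of q' raises k at l' before l, the reverse of
  the order in the recursion. Increments of k commute, so swapping the two sums repairs
  this.\<close>

lemma loss_deriv_has_derivative:
  assumes \<rho>: "\<rho> \<in> carrier_mat n n" and Ob: "Ob \<in> carrier_mat n n"
  shows "((\<lambda>t. loss_deriv V H S M \<rho> Ob qs k (\<theta>(q := t))) has_real_derivative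
    loss_deriv V H S M \<rho> Ob (q # qs) k (\<theta>(q := t))) (at t)"
proof (induction qs arbitrary: k)
  case Nil
  have "((\<lambda>s. mtrace (\<rho> * heisenberg V H S k [0..<M] (\<theta>(q := s)) Ob)) has_vector_derivative
      (\<Sum>l | l < M \<and> S l = q. mtrace (\<rho> * heisenberg V H S (k(l := Suc (k l))) [0..<M] (\<theta>(q := t)) Ob))) (at t)"
    using heisenberg_deriv[OF \<rho> _ _ has_mat_deriv_const[OF Ob], of "[0..<M]" k \<theta> q t] mtrace_heisenberg_zero[OF \<rho>, of "[0..<M]"] by (auto simp: atLeast0LessThan)
  from bounded_linear.has_vector_derivative[OF bounded_linear_Re this]
  show ?case by (simp only: loss_deriv.simps has_real_derivative_iff_has_vector_derivative Re_sum)
next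
  case (Cons q' qs)
  have "((\<lambda>t. loss_deriv V H S M \<rho> Ob (q' # qs) k (\<theta>(q := t))) has_real_derivative
      (\<Sum>l' | l' < M \<and> S l' = q'. loss_deriv V H S M \<rho> Ob (q # qs) (k(l' := Suc (k l'))) (\<theta>(q := t)))) (at t)"
    unfolding loss_deriv.simps(2)[of _ _ _ _ _ _ q'] by (intro DERIV_sum Cons)
  also have "(\<Sum>l' | l' < M \<and> S l' = q'. loss_deriv V H S M \<rho> Ob (q # qs) (k(l' := Suc (k l'))) (\<theta>(q := t)))
     = (\<Sum>l' | l' < M \<and> S l' = q'. \<Sum>l | l < M \<and> S l = q.
          loss_deriv V H S M \<rho> Ob qs ((k(l := Suc (k l)))(l' := Suc ((k(l := Suc (k l))) l'))) (\<theta>(q := t)))"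
    unfolding loss_deriv.simps by (intro sum.cong refl arg_cong2[where f = "loss_deriv V H S M \<rho> Ob qs"]) auto
  also have "\<dots> = loss_deriv V H S M \<rho> Ob (q # q' # qs) k (\<theta>(q := t))"
    unfolding loss_deriv.simps by (rule sum.swap)
  finally show ?case .
qed

text \<open>Each increment of k at l contributes one factor \<open>width l\<close>, and summing over
  the gates that share q turns these factors into \<open>omega_max\<close>. The induction needs
  arbitrary k; at k = 0 the product of widths is 1.\<close>

lemma loss_deriv_bound:
  assumes \<rho>: "density_op d \<rho>" and n: "n = 2 ^ d" and Ob: "Ob \<in> carrier_mat n n"
  shows "\<bar>loss_deriv V H S M \<rho> Ob qs k \<theta>\<bar>
    \<le> opnorm Ob * (\<Prod>l<M. width l ^ k l) * prod_list (map (omega_max H S M) qs)"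
proof (induction qs arbitrary: k)
  case Nil
  have sub: "set [0..<M] \<subseteq> {..<M}" by auto
  have "(\<Prod>l\<leftarrow>[0..<M]. width l ^ k l) = (\<Prod>l<M. width l ^ k l)"
    by (subst prod.distinct_set_conv_list[symmetric]) (auto simp: atLeast0LessThan)
  moreover have "0 \<le> (\<Prod>l<M. width l ^ k l)"
    by (rule prod_nonneg, rule zero_le_power, rule width_nonneg) simp
  ultimately have "cmod (mtrace (\<rho> * heisenberg V H S k [0..<M] \<theta> Ob)) \<le> opnorm Ob * (\<Prod>l<M. width l ^ k l)"
    using heisenberg_carrier[OF sub Ob, of k \<theta>] op_bounded_by_heisenberg[OF sub Ob op_bounded_by_opnorm[OF Ob] opnorm_nonneg[OF Ob], of k \<theta>]
      opnorm_nonneg[OF Ob]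
    by (intro cmod_mtrace_density_le[OF \<rho>]) (auto simp: n)
  then show ?case using abs_Re_le_cmod order_trans by auto
next
  case (Cons q qs)
  have P: "(\<Prod>j<M. width j ^ (k(l := Suc (k l))) j) = (\<Prod>j<M. width j ^ k j) * width l" if "l < M" for l
    using that by (simp add: prod.remove[of "{..<M}" l] mult_ac)
  have "\<bar>loss_deriv V H S M \<rho> Ob qs (k(l := Suc (k l))) \<theta>\<bar>
      \<le> width l * (opnorm Ob * (\<Prod>l<M. width l ^ k l) * prod_list (map (omega_max H S M) qs))" if "l < M" for l
    using Cons.IH[of "k(l := Suc (k l))"] unfolding P[OF that] by (simp only: mult_ac)
  then have "\<bar>loss_deriv V H S M \<rho> Ob (q # qs) k \<theta>\<bar>
      \<le> (\<Sum>l | l < M \<and> S l = q. width l * (opnorm Ob * (\<Prod>l<M. width l ^ k l) * prod_list (map (omega_max H S M) qs)))"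
    unfolding loss_deriv.simps by (intro order_trans[OF sum_abs] sum_mono) auto
  also have "\<dots> = omega_max H S M q * (opnorm Ob * (\<Prod>l<M. width l ^ k l) * prod_list (map (omega_max H S M) qs))"
    by (simp add: omega_max_def sum_distrib_right)
  finally show ?case by (simp add: mult_ac)
qed

lemma loss_deriv_measurable:
  assumes \<rho>: "\<rho> \<in> carrier_mat n n" and Ob: "Ob \<in> carrier_mat n n"
    and g: "\<And>l. l < M \<Longrightarrow> (\<lambda>x. g x (S l)) \<in> borel_measurable N"
  shows "(\<lambda>x. loss_deriv V H S M \<rho> Ob qs k (g x)) \<in> borel_measurable N"
proof (induction qs arbitrary: k)
  case Nil
  let ?h = "\<lambda>x. heisenberg V H S k [0..<M] (g x) Ob"
  have c: "?h x \<in> carrier_mat n n" for x by (rule heisenberg_carrier) (use Ob in auto)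
  have "(\<rho> * ?h x) $$ (i,i) = (\<Sum>l<n. \<rho> $$ (i,l) * ?h x $$ (l,i))" if "i < n" for i x
    using \<rho> c that by (intro index_mult_mat_sum)
  then have "mtrace (\<rho> * ?h x) = (\<Sum>i<n. \<Sum>l<n. \<rho> $$ (i,l) * ?h x $$ (l,i))" for x
    using \<rho> unfolding mtrace_def by (simp del: index_mult_mat(1))
  moreover have "(\<lambda>x. \<Sum>i<n. \<Sum>l<n. \<rho> $$ (i,l) * ?h x $$ (l,i)) \<in> borel_measurable N"
    using g Ob by (intro borel_measurable_sum borel_measurable_times heisenberg_measurable) auto
  ultimately have "(\<lambda>x. mtrace (\<rho> * ?h x)) \<in> borel_measurable N" by simp
  then show ?case by simp
next
  case (Cons q qs)
  then show ?case by simp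
qed

lemma loss_deriv_cong:
  assumes "\<And>l. l < M \<Longrightarrow> \<theta> (S l) = \<theta>' (S l)"
  shows "loss_deriv V H S M \<rho> Ob qs k \<theta> = loss_deriv V H S M \<rho> Ob qs k \<theta>'"
proof (induction qs arbitrary: k)
  case Nil
  have "heisenberg V H S k [0..<M] \<theta> Ob = heisenberg V H S k [0..<M] \<theta>' Ob"
    using assms by (intro heisenberg_cong_param) auto
  then show ?case by simp
qed simp

end

section \<open>The loss as a derivative family\<close>

lemma circuit_qc_instance:
  assumes "qc_instance n \<rho> Ob V H M m S"
  shows "circuit (2 ^ n) V H M"
  using assms unfolding qc_instance_def circuit_def hermitian_def unitary_def by fastforce

text \<open>Cyclicity of the trace moves the circuit from the state to the observable.\<close>

lemma loss_eq_loss_deriv: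
  assumes qc: "qc_instance n \<rho> Ob V H M m S"
  shows "loss n \<rho> Ob V H S M = loss_deriv V H S M \<rho> Ob [] (\<lambda>_. 0)"
proof
  fix \<theta>
  interpret circuit "2 ^ n" V H S M by (rule circuit_qc_instance[OF qc])
  have c: "\<rho> \<in> carrier_mat (2^n) (2^n)" "Ob \<in> carrier_mat (2^n) (2^n)"
    using qc unfolding qc_instance_def density_op_def by auto
  define U where "U = circ (2^n) V H S \<theta> [0..<M]"
  have U: "U \<in> carrier_mat (2^n) (2^n)" unfolding U_def by (rule circ_carrier) auto
  have "mtrace (U * \<rho> * mat_adjoint U * Ob) = mtrace (U * (\<rho> * (mat_adjoint U * Ob)))"
    using c U by (simp add: assoc_mult_mat[of _ "2^n" "2^n" _ "2^n" _ "2^n"])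
  also have "\<dots> = mtrace (\<rho> * (mat_adjoint U * Ob) * U)"
    using c U by (intro mtrace_mult_commute[of _ "2^n" "2^n"]) auto
  also have "\<rho> * (mat_adjoint U * Ob) * U = \<rho> * (mat_adjoint U * Ob * U)"
    using c U by (simp add: assoc_mult_mat[of _ "2^n" "2^n" _ "2^n" _ "2^n"])
  also have "mat_adjoint U * Ob * U = heisenberg V H S (\<lambda>_. 0) [0..<M] \<theta> Ob"
    unfolding U_def using c by (intro heisenberg_circ) auto
  finally show "loss n \<rho> Ob V H S M \<theta> = loss_deriv V H S M \<rho> Ob [] (\<lambda>_. 0) \<theta>"
    by (simp add: loss_def U_circ_def U_def)
qed

lemma derivative_family_loss:
  assumes qc: "qc_instance n \<rho> Ob V H M m S"
  shows "derivative_family m (\<lambda>qs. loss_deriv V H S M \<rho> Ob qs (\<lambda>_. 0)) (opnorm Ob) (omega_max H S M)"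
proof -
  interpret circuit "2 ^ n" V H S M by (rule circuit_qc_instance[OF qc])
  have S: "S l < m" if "l < M" for l
    using qc that unfolding qc_instance_def by auto
  have c: "\<rho> \<in> carrier_mat (2^n) (2^n)" "Ob \<in> carrier_mat (2^n) (2^n)" and d: "density_op n \<rho>"
    using qc unfolding qc_instance_def density_op_def by auto
  show ?thesis
  proof
    show "\<bar>loss_deriv V H S M \<rho> Ob qs (\<lambda>_. 0) \<theta>\<bar> \<le> opnorm Ob * prod_list (map (omega_max H S M) qs)" for qs \<theta>
      using loss_deriv_bound[OF d refl c(2), of qs "\<lambda>_. 0" \<theta>] by simp
  qed (use S c in \<open>auto intro!: loss_deriv_has_derivative loss_deriv_measurable loss_deriv_cong
      simp del: loss_deriv.simps\<close>)
qed

lemma c_p_eq_loss_deriv: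
  assumes qc: "qc_instance n \<rho> Ob V H M m S" and p: "p < m"
  shows "c_p n \<rho> Ob V H S M \<phi> p = \<bar>loss_deriv V H S M \<rho> Ob [p, p] (\<lambda>_. 0) \<phi>\<bar>"
proof -
  interpret derivative_family m "\<lambda>qs. loss_deriv V H S M \<rho> Ob qs (\<lambda>_. 0)" "opnorm Ob" "omega_max H S M"
    by (rule derivative_family_loss[OF qc])
  have 1: "deriv (\<lambda>t. loss n \<rho> Ob V H S M (\<phi>(p := t))) = (\<lambda>t. loss_deriv V H S M \<rho> Ob [p] (\<lambda>_. 0) (\<phi>(p := t)))"
    unfolding loss_eq_loss_deriv[OF qc] by (intro ext DERIV_imp_deriv deriv_F p)
  show ?thesis
    unfolding c_p_def 1 using DERIV_imp_deriv[OF deriv_F[OF p, of "[p]" \<phi> "\<phi> p"]]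
    by (simp only: fun_upd_triv)
qed

lemma omega_max_nonneg:
  assumes "qc_instance n \<rho> Ob V H M m S"
  shows "0 \<le> omega_max H S M q"
proof -
  interpret circuit "2 ^ n" V H S M by (rule circuit_qc_instance[OF assms])
  show ?thesis unfolding omega_max_def by (intro sum_nonneg) (auto dest: width_nonneg)
qed

text \<open>The second-order derivative bound at \<phi>. It lets the quartic Taylor error be
  absorbed, and for c > 0 it makes the denominator of \<open>r_patch_sq\<close> positive.\<close>

lemma c_p_le:
  assumes qc: "qc_instance n \<rho> Ob V H M m S" and p: "p < m"
  shows "c_p n \<rho> Ob V H S M \<phi> p \<le> opnorm Ob * (omega_max H S M p)\<^sup>2"
proof -
  interpret derivative_family m "\<lambda>qs. loss_deriv V H S M \<rho> Ob qs (\<lambda>_. 0)" "opnorm Ob" "omega_max H S M"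
    by (rule derivative_family_loss[OF qc])
  show ?thesis
    using bound_F[of "[p, p]" \<phi>] p unfolding c_p_eq_loss_deriv[OF qc p] by (simp add: power2_eq_square)
qed

section \<open>Scalar inequalities behind the constants\<close>

text \<open>A vanishing numerator or denominator makes the quotient 0, by the convention for
  division by zero, and r > 0 excludes this; then the fraction can be cleared.\<close>

lemma r_patch_sq_leD:
  assumes "0 \<le> c" "0 \<le> on" "0 \<le> s" "0 < r" "r\<^sup>2 \<le> r_patch_sq c on wp s"
  shows "0 < c" "8 * (16 * c * (on * wp\<^sup>2 * s * r\<^sup>2) + 32 * (on\<^sup>2 * wp ^ 6 * r\<^sup>2)) \<le> 9 * c\<^sup>2"
proof -
  define d where "d = 8 * (16 * c * on * wp\<^sup>2 * s + 32 * on\<^sup>2 * wp ^ 6)"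
  have "0 \<le> on\<^sup>2 * wp ^ 6" by (simp add: zero_le_even_power)
  then have d0: "0 \<le> d" using assms by (simp add: d_def)
  have "0 < r\<^sup>2" using assms by simp
  with assms(5) have *: "0 < r_patch_sq c on wp s" by linarith
  then have "d \<noteq> 0" "c \<noteq> 0" unfolding r_patch_sq_def d_def[symmetric] by auto
  with d0 assms show "0 < c" by simp
  have "r\<^sup>2 * d \<le> 9 * c\<^sup>2"
    using assms(5) d0 \<open>d \<noteq> 0\<close> unfolding r_patch_sq_def d_def[symmetric] by (simp add: pos_le_divide_eq)
  then show "8 * (16 * c * (on * wp\<^sup>2 * s * r\<^sup>2) + 32 * (on\<^sup>2 * wp ^ 6 * r\<^sup>2)) \<le> 9 * c\<^sup>2"
    by (simp add: d_def algebra_simps)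
qed

text \<open>The fourth-order Taylor error is first order in \<open>r\<^sup>2\<close>, like the term
  \<open>32/3 on\<^sup>2 wp\<^sup>6 r\<^sup>2\<close> that has to absorb it, because \<open>c \<le> on wp\<^sup>2\<close>.\<close>

lemma legendre_coefficient_bound:
  fixes c g on wp s r K :: real
  assumes c: "c = \<bar>g\<bar>" "c \<le> on * wp\<^sup>2" and nn: "0 \<le> on" "0 \<le> s" "0 < r"
    and r: "r\<^sup>2 \<le> r_patch_sq c on wp s"
    and K: "\<bar>K - 2 * r ^ 4 / 45 * g\<bar> \<le> on * wp ^ 4 * r ^ 6 / 36 + 2 * r ^ 4 / 45 * (on * wp\<^sup>2 * s * r\<^sup>2 / 2)"
  shows "r ^ 4 / 45 * ((c - 8/3 * on * wp\<^sup>2 * s * r\<^sup>2)\<^sup>2 - 32/3 * on\<^sup>2 * wp ^ 6 * r\<^sup>2) \<le> 45 / (4 * r ^ 4) * K\<^sup>2"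
proof -
  define X where "X = on * wp\<^sup>2 * s * r\<^sup>2"
  define Y where "Y = on * wp ^ 4 * r\<^sup>2"
  define Z where "Z = on\<^sup>2 * wp ^ 6 * r\<^sup>2"
  have X0: "0 \<le> X" and Y0: "0 \<le> Y" using nn by (simp_all add: X_def Y_def zero_le_even_power)
  have "c * Y \<le> (on * wp\<^sup>2) * Y" using c Y0 by (intro mult_right_mono)
  also have "\<dots> = Z" by (simp add: Y_def Z_def power2_eq_square eval_nat_numeral)
  finally have cYZ: "c * Y \<le> Z" .
  have c0: "0 < c" and XZ: "8 * (16 * c * X + 32 * Z) \<le> 9 * c\<^sup>2"
    using r_patch_sq_leD[OF _ nn r] c by (auto simp: X_def Z_def)
  have cX0: "0 \<le> c * X" "0 \<le> c * Y" using c0 X0 Y0 by simp_all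
  \<comment> \<open>Cancelling one factor c from the patch condition bounds X and Y separately by
    multiples of c; for Y this passes through c Y <= Z.\<close>
  have "c * (128 * X) \<le> c * (9 * c)" "c * (256 * Y) \<le> c * (9 * c)"
    using XZ cYZ cX0 by (simp_all add: power2_eq_square algebra_simps)
  then have X1: "128 * X \<le> 9 * c" and Y1: "256 * Y \<le> 9 * c" using c0 by simp_all
  \<comment> \<open>K rescaled to estimate g: in these units the Cauchy-Schwarz bound is \<kappa>^2
    r^4 / 45.\<close>
  define \<kappa> where "\<kappa> = 45 / (2 * r ^ 4) * K"
  have r4: "0 < r ^ 4" using nn by simp
  \<comment> \<open>The coefficient 5/8 is 45/2 divided by 36. The other coefficient, 1/2, is later
    relaxed to 8/3.\<close>
  have "45 / (2 * r ^ 4) * \<bar>K - 2 * r ^ 4 / 45 * g\<bar> \<le> 45 / (2 * r ^ 4) * (r ^ 4 * (Y / 36 + 2 / 45 * (X / 2)))"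
    using r4 K by (intro mult_left_mono) (auto simp: X_def Y_def algebra_simps eval_nat_numeral)
  also have "\<dots> = 5/8 * Y + X / 2" using r4 by (simp add: field_simps)
  also have "45 / (2 * r ^ 4) * \<bar>K - 2 * r ^ 4 / 45 * g\<bar> = \<bar>\<kappa> - g\<bar>"
  proof -
    have "\<kappa> - g = 45 / (2 * r ^ 4) * (K - 2 * r ^ 4 / 45 * g)"
      using r4 by (simp add: \<kappa>_def field_simps)
    then have "\<bar>\<kappa> - g\<bar> = \<bar>45 / (2 * r ^ 4)\<bar> * \<bar>K - 2 * r ^ 4 / 45 * g\<bar>" by (simp only: abs_mult)
    then show ?thesis using r4 by simp
  qed
  finally have "\<bar>\<kappa> - g\<bar> \<le> 5/8 * Y + X / 2" .
  then have \<kappa>: "c - 8/3 * X - 5/8 * Y \<le> \<bar>\<kappa>\<bar>" using c(1) X0 by linarith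
  define a where "a = c - 8/3 * X"
  \<comment> \<open>Nonnegativity is required before squaring: 8/3 X <= 3/16 c and 5/8 Y <= 45/2048
    c.\<close>
  have "0 \<le> a - 5/8 * Y" using X1 Y1 c0 unfolding a_def by linarith
  then have "(a - 5/8 * Y)\<^sup>2 \<le> \<kappa>\<^sup>2" using power_mono[of "a - 5/8 * Y" "\<bar>\<kappa>\<bar>" 2] \<kappa> by (simp add: a_def)
  moreover have "(a - 5/8 * Y)\<^sup>2 = a\<^sup>2 - 5/4 * (a * Y) + 25/64 * Y\<^sup>2"
    by (simp add: power2_eq_square algebra_simps)
  moreover have "a * Y \<le> c * Y" using X0 Y0 by (intro mult_right_mono) (auto simp: a_def)
  moreover have "0 \<le> Y\<^sup>2" by simp
  \<comment> \<open>The cross term 5/4 a Y is at most 5/4 c Y <= 5/4 Z, well within 32/3 Z.\<close>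
  ultimately have "a\<^sup>2 - 32/3 * Z \<le> \<kappa>\<^sup>2" using cYZ cX0 by linarith
  then have "r ^ 4 / 45 * (a\<^sup>2 - 32/3 * Z) \<le> r ^ 4 / 45 * \<kappa>\<^sup>2"
    using r4 by (intro mult_left_mono) auto
  also have "\<dots> = 45 / (4 * r ^ 4) * K\<^sup>2"
    using r4 by (simp add: \<kappa>_def power2_eq_square field_simps)
  finally show ?thesis by (simp add: a_def X_def Z_def mult.assoc)
qed

text \<open>Expanding the square, the losses 16/3 c X + 32/3 Z are 1/24 of 128 c X + 256 Z, which
  the patch condition bounds by 9 c^2. So at least (1 - 9/24) c^2 = 5/8 c^2 survives, and 5/8
  divided by 45 is 1/72.\<close>

lemma patch_bound_ge:
  fixes c on wp s r :: real
  assumes nn: "0 \<le> c" "0 \<le> on" "0 \<le> s" "0 < r" and r: "r\<^sup>2 \<le> r_patch_sq c on wp s"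
  shows "1/72 * c\<^sup>2 * r ^ 4 \<le> r ^ 4 / 45 * ((c - 8/3 * on * wp\<^sup>2 * s * r\<^sup>2)\<^sup>2 - 32/3 * on\<^sup>2 * wp ^ 6 * r\<^sup>2)"
proof -
  define X where "X = on * wp\<^sup>2 * s * r\<^sup>2"
  define Z where "Z = on\<^sup>2 * wp ^ 6 * r\<^sup>2"
  have XZ: "128 * (c * X) + 256 * Z \<le> 9 * c\<^sup>2"
    using r_patch_sq_leD(2)[OF nn r] by (simp add: X_def Z_def)
  have "(c - 8/3 * X)\<^sup>2 = c\<^sup>2 - 16/3 * (c * X) + 64/9 * X\<^sup>2" by (simp add: power2_eq_square algebra_simps)
  then have "5/8 * c\<^sup>2 \<le> (c - 8/3 * X)\<^sup>2 - 32/3 * Z" using XZ zero_le_power2[of X] by linarith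
  then have "r ^ 4 / 45 * (5/8 * c\<^sup>2) \<le> r ^ 4 / 45 * ((c - 8/3 * X)\<^sup>2 - 32/3 * Z)"
    by (intro mult_left_mono) auto
  then show ?thesis by (simp add: X_def Z_def mult_ac)
qed

lemma variance_loss_ge:
  assumes qc: "qc_instance n \<rho> Ob V H M m S" and p: "p < m" and r: "0 < r"
    "r\<^sup>2 \<le> r_patch_sq (c_p n \<rho> Ob V H S M \<phi> p) (opnorm Ob) (omega_max H S M p)
       (\<Sum>q\<in>{..<m} - {p}. (omega_max H S M q)\<^sup>2)"
  shows "variance_on (unif_box m \<phi> r) (loss n \<rho> Ob V H S M) \<ge>
    r ^ 4 / 45 * ((c_p n \<rho> Ob V H S M \<phi> p - 8/3 * opnorm Ob * (omega_max H S M p)\<^sup>2 *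
        (\<Sum>q\<in>{..<m} - {p}. (omega_max H S M q)\<^sup>2) * r\<^sup>2)\<^sup>2 - 32/3 * (opnorm Ob)\<^sup>2 * omega_max H S M p ^ 6 * r\<^sup>2)"
proof -
  interpret derivative_family m "\<lambda>qs. loss_deriv V H S M \<rho> Ob qs (\<lambda>_. 0)" "opnorm Ob" "omega_max H S M"
    by (rule derivative_family_loss[OF qc])
  obtain K where K: "variance_on (unif_box m \<phi> r) (loss_deriv V H S M \<rho> Ob [] (\<lambda>_. 0)) \<ge> 45 / (4 * r ^ 4) * K\<^sup>2"
    "\<bar>K - 2 * r ^ 4 / 45 * loss_deriv V H S M \<rho> Ob [p, p] (\<lambda>_. 0) \<phi>\<bar> \<le> opnorm Ob * omega_max H S M p ^ 4 * r ^ 6 / 36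
       + 2 * r ^ 4 / 45 * (opnorm Ob * (omega_max H S M p)\<^sup>2 * (\<Sum>q\<in>{..<m} - {p}. (omega_max H S M q)\<^sup>2) * r\<^sup>2 / 2)"
    using variance_family[OF r(1) p] by blast
  have on: "0 \<le> opnorm Ob" using qc opnorm_nonneg unfolding qc_instance_def by blast
  have s: "0 \<le> (\<Sum>q\<in>{..<m} - {p}. (omega_max H S M q)\<^sup>2)" by (simp add: sum_nonneg)
  show ?thesis
    using legendre_coefficient_bound[OF c_p_eq_loss_deriv[OF qc p] c_p_le[OF qc p] on s r K(2)] K(1)
    unfolding loss_eq_loss_deriv[OF qc] by linarith
qed

lemma c_p_nonneg: "0 \<le> c_p n \<rho> Ob V H S M \<phi> p"
  by (simp add: c_p_def)

lemma variance_loss_ge_patch: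
  assumes qc: "qc_instance n \<rho> Ob V H M m S" and p: "p < m" and r: "0 < r"
    "r\<^sup>2 \<le> r_patch_sq (c_p n \<rho> Ob V H S M \<phi> p) (opnorm Ob) (omega_max H S M p)
       (\<Sum>q\<in>{..<m} - {p}. (omega_max H S M q)\<^sup>2)"
  shows "variance_on (unif_box m \<phi> r) (loss n \<rho> Ob V H S M) \<ge> 1/72 * (c_p n \<rho> Ob V H S M \<phi> p)\<^sup>2 * r ^ 4"
proof -
  have on: "0 \<le> opnorm Ob" using qc opnorm_nonneg unfolding qc_instance_def by blast
  have s: "0 \<le> (\<Sum>q\<in>{..<m} - {p}. (omega_max H S M q)\<^sup>2)" by (simp add: sum_nonneg)
  show ?thesis
    using patch_bound_ge[OF c_p_nonneg on s r] variance_loss_ge[OF qc p r] by linarith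
qed

section \<open>Polynomial scaling\<close>

text \<open>Norm bounds on single generators do not control \<open>omega_max\<close>, which adds up
  all gates sharing q; the bound on their number does. The factor 2 is the width of a spectrum
  inside [-h, h].\<close>

lemma omega_max_le:
  assumes qc: "qc_instance n \<rho> Ob V H M m S" and "\<And>l. l < M \<Longrightarrow> opnorm (H l) \<le> h"
    and "real (card {l. l < M \<and> S l = q}) \<le> a" and "0 \<le> h"
  shows "omega_max H S M q \<le> 2 * a * h"
proof -
  interpret circuit "2 ^ n" V H S M by (rule circuit_qc_instance[OF qc])
  have "omega_max H S M q \<le> (\<Sum>l | l < M \<and> S l = q. 2 * h)"
    unfolding omega_max_def
  proof (intro sum_mono)
    fix l assume "l \<in> {l. l < M \<and> S l = q}"
    then have l: "l < M" by simp
    show "width l \<le> 2 * h"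
      using lam_diff_le_opnorm[OF H[OF l] n_pos] assms(2)[OF l] by linarith
  qed
  also have "\<dots> = real (card {l. l < M \<and> S l = q}) * (2 * h)" by simp
  also have "\<dots> \<le> a * (2 * h)" using assms by (intro mult_right_mono) auto
  finally show ?thesis by simp
qed

text \<open>Both terms of the denominator are bounded through m B^2 W^6, the first by c <= on wp^2
  and the second by 1 <= m, so 384 = 8 (16 + 32). Positivity of c forces on and wp, hence the
  denominator, to be positive.\<close>

lemma le_r_patch_sq:
  fixes c on wp s W r m :: real
  assumes c: "0 < c" "c \<le> on * wp\<^sup>2" and on: "0 \<le> on" "on \<le> B" and wp: "0 \<le> wp" "wp \<le> W"
    and s: "0 \<le> s" "s \<le> m * W\<^sup>2" and m: "1 \<le> m" and r: "r\<^sup>2 * (384 * m * B\<^sup>2 * W ^ 6) \<le> 9 * c\<^sup>2"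
  shows "r\<^sup>2 \<le> r_patch_sq c on wp s"
proof -
  define d where "d = 8 * (16 * c * on * wp\<^sup>2 * s + 32 * on\<^sup>2 * wp ^ 6)"
  have "0 < on * wp\<^sup>2" using c by linarith
  then have "0 < on" "0 < wp" using on wp by (auto simp: zero_less_mult_iff)
  then have "0 < on\<^sup>2 * wp ^ 6" by simp
  moreover have "0 \<le> c * on * wp\<^sup>2 * s" using c on s by simp
  ultimately have d0: "0 < d" by (simp add: d_def)
  have B: "0 \<le> B" and W: "0 \<le> W" using on wp by auto
  have "c * on * wp\<^sup>2 * s \<le> (on * wp\<^sup>2) * on * wp\<^sup>2 * s"
    using c on s by (intro mult_right_mono) auto
  also have "\<dots> \<le> (B * W\<^sup>2) * B * W\<^sup>2 * (m * W\<^sup>2)"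
    using on wp s B W by (intro mult_mono power_mono) auto
  also have "\<dots> = m * (B\<^sup>2 * W ^ 6)" by (simp add: power2_eq_square eval_nat_numeral)
  finally have 1: "c * on * wp\<^sup>2 * s \<le> m * (B\<^sup>2 * W ^ 6)" .
  have "on\<^sup>2 * wp ^ 6 \<le> B\<^sup>2 * W ^ 6"
    using on wp B W by (intro mult_mono power_mono) auto
  also have "\<dots> \<le> m * (B\<^sup>2 * W ^ 6)" using m W mult_right_mono[of 1 m "B\<^sup>2 * W ^ 6"] by simp
  finally have "d \<le> 384 * m * B\<^sup>2 * W ^ 6" using 1 by (simp add: d_def)
  then have "r\<^sup>2 * d \<le> r\<^sup>2 * (384 * m * B\<^sup>2 * W ^ 6)" by (intro mult_left_mono) auto
  then have "r\<^sup>2 * d \<le> 9 * c\<^sup>2" using r by linarith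
  then show ?thesis unfolding r_patch_sq_def d_def[symmetric] using d0 by (simp add: pos_le_divide_eq)
qed

lemma variance_loss_scaling:
  fixes \<rho> Ob :: "nat \<Rightarrow> complex mat" and V H :: "nat \<Rightarrow> nat \<Rightarrow> complex mat" and M m :: "nat \<Rightarrow> nat"
    and S :: "nat \<Rightarrow> nat \<Rightarrow> nat" and \<phi> :: "nat \<Rightarrow> nat \<Rightarrow> real" and p :: "nat \<Rightarrow> nat"
  assumes qc: "\<And>n. qc_instance n (\<rho> n) (Ob n) (V n) (H n) (M n) (m n) (S n)" and p: "\<And>n. p n < m n"
    and ob: "\<forall>\<^sub>F n in sequentially. opnorm (Ob n) \<le> a1 * real (n + 1) ^ k1"
    and h: "\<forall>\<^sub>F n in sequentially. \<forall>l < M n. opnorm (H n l) \<le> a2 * real (n + 1) ^ k2"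
    and card: "\<forall>\<^sub>F n in sequentially. \<forall>q < m n. real (card {l. l < M n \<and> S n l = q}) \<le> a3 * real (n + 1) ^ k3"
    and a4: "a4 > 0" and c: "\<forall>\<^sub>F n in sequentially.
        c_p n (\<rho> n) (Ob n) (V n) (H n) (S n) (M n) (\<phi> n) (p n) \<ge> 1 / (a4 * real (n + 1) ^ k4)"
  shows "\<exists>(r::nat \<Rightarrow> real) k c1 c2 b j. c1 > 0 \<and> c2 > 0 \<and> b > 0 \<and>
         (\<forall>\<^sub>F n in sequentially.
            c1 / (real (n + 1) ^ k * sqrt (real (m n))) \<le> r n \<and>
            r n \<le> c2 / (real (n + 1) ^ k * sqrt (real (m n))) \<and>
            variance_on (unif_box (m n) (\<phi> n) (r n)) (loss n (\<rho> n) (Ob n) (V n) (H n) (S n) (M n))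
              \<ge> 1 / (b * real (n + 1) ^ j * (real (m n))\<^sup>2))"
proof -
  \<comment> \<open>The hypotheses do not fix the signs of a1, a2, a3; these larger constants are
    positive.\<close>
  define b1 b2 b3 where "b1 = \<bar>a1\<bar> + 1" and "b2 = \<bar>a2\<bar> + 1" and "b3 = \<bar>a3\<bar> + 1"
  have b: "0 < b1" "0 < b2" "0 < b3" by (auto simp: b1_def b2_def b3_def)
  define w where "w = 2 * b3 * b2"
  have w: "0 < w" using b by (simp add: w_def)
  define kw where "kw = k3 + k2"
  \<comment> \<open>r has to be of order C / (B W^3 sqrt m), where C is at least of order N^(-k4), B
    of order N^k1 and W of order N^kw.\<close>
  define k where "k = k4 + k1 + 3 * kw"
  \<comment> \<open>The 7 is there because 384/49 <= 9, which places r inside the patch.\<close>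
  define c1 where "c1 = 1 / (7 * a4 * b1 * w ^ 3)"
  have c1: "0 < c1" using a4 b w by (simp add: c1_def)
  define r where "r n = c1 / (real (n + 1) ^ k * sqrt (real (m n)))" for n
  \<comment> \<open>Chosen, with the exponent 4k + 2 k4, so that the claimed rate equals C^2 r^4 /
    72 with C replaced by its lower bound.\<close>
  define bb where "bb = 72 * a4\<^sup>2 / c1 ^ 4"
  have bb: "0 < bb" using a4 c1 by (simp add: bb_def)
  have "\<forall>\<^sub>F n in sequentially. variance_on (unif_box (m n) (\<phi> n) (r n)) (loss n (\<rho> n) (Ob n) (V n) (H n) (S n) (M n))
              \<ge> 1 / (bb * real (n + 1) ^ (4 * k + 2 * k4) * (real (m n))\<^sup>2)"
    using ob h card c
  proof eventually_elim
    case (elim n)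
    define N where "N = real (n + 1)"
    have N: "0 < N" by (simp add: N_def)
    define C where "C = c_p n (\<rho> n) (Ob n) (V n) (H n) (S n) (M n) (\<phi> n) (p n)"
    define mm where "mm = real (m n)"
    have mm: "1 \<le> mm" using p[of n] by (simp add: mm_def)
    define B where "B = b1 * N ^ k1"
    define W where "W = w * N ^ kw"
    have mono: "a * N ^ i \<le> (\<bar>a\<bar> + 1) * N ^ i" for a i
      using N by (intro mult_right_mono) auto
    have on: "opnorm (Ob n) \<le> B"
      using elim(1) mono[of a1 k1] unfolding B_def b1_def N_def by linarith
    have om: "omega_max (H n) (S n) (M n) q \<le> W" if "q < m n" for q
    proof -
      have "omega_max (H n) (S n) (M n) q \<le> 2 * (b3 * N ^ k3) * (b2 * N ^ k2)"
      proof (rule omega_max_le[OF qc])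
        show "opnorm (H n l) \<le> b2 * N ^ k2" if "l < M n" for l
          using elim(2) that mono[of a2 k2] unfolding b2_def N_def by (meson order_trans)
        show "real (card {l. l < M n \<and> S n l = q}) \<le> b3 * N ^ k3"
          using elim(3) that mono[of a3 k3] unfolding b3_def N_def by (meson order_trans)
      qed (use b N in auto)
      also have "\<dots> = W" by (simp add: W_def w_def kw_def power_add)
      finally show ?thesis .
    qed
    have C: "1 / (a4 * N ^ k4) \<le> C" using elim(4) by (simp add: C_def N_def)
    moreover have "0 < 1 / (a4 * N ^ k4)" using a4 N by simp
    ultimately have C0: "0 < C" by linarith
    have r0: "0 < r n" using c1 mm N by (simp add: r_def N_def mm_def)
    have rsq: "(r n)\<^sup>2 = c1\<^sup>2 / (N ^ (2 * k) * mm)"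
      using mm by (simp add: r_def N_def mm_def power_divide power_mult_distrib power_mult[symmetric] mult.commute)
    then have r2: "(r n)\<^sup>2 * mm = c1\<^sup>2 / N ^ (2 * k)" using mm by simp
    have sumW: "(\<Sum>q\<in>{..<m n} - {p n}. (omega_max (H n) (S n) (M n) q)\<^sup>2) \<le> mm * W\<^sup>2"
    proof -
      have "(\<Sum>q\<in>{..<m n} - {p n}. (omega_max (H n) (S n) (M n) q)\<^sup>2) \<le> (\<Sum>q\<in>{..<m n} - {p n}. W\<^sup>2)"
        using om omega_max_nonneg[OF qc] by (intro sum_mono power_mono) auto
      also have "\<dots> \<le> (\<Sum>q<m n. W\<^sup>2)" by (intro sum_mono2) auto
      finally show ?thesis by (simp add: mm_def)
    qed
    have "(r n)\<^sup>2 * (384 * mm * B\<^sup>2 * W ^ 6) = 384 * ((r n)\<^sup>2 * mm) * B\<^sup>2 * W ^ 6"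
      by simp
    also have "\<dots> = 384 / 49 * (1 / (a4 * N ^ k4)\<^sup>2)"
    proof -
      have "N ^ (2 * k) = (N ^ k4)\<^sup>2 * (N ^ k1)\<^sup>2 * (N ^ kw) ^ 6"
        by (simp add: k_def power_mult[symmetric] power_add[symmetric] algebra_simps)
      then show ?thesis
        unfolding r2 B_def W_def c1_def using N a4 b w
        by (simp add: power_mult_distrib power_divide power_mult[symmetric] field_simps)
    qed
    also have "\<dots> \<le> 9 * (1 / (a4 * N ^ k4)\<^sup>2)" by (intro mult_right_mono) auto
    also have "\<dots> \<le> 9 * C\<^sup>2"
      using power_mono[OF C, of 2] a4 N by (simp add: power_divide)
    finally have small: "(r n)\<^sup>2 * (384 * mm * B\<^sup>2 * W ^ 6) \<le> 9 * C\<^sup>2" .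
    have on0: "0 \<le> opnorm (Ob n)" using qc[of n] opnorm_nonneg unfolding qc_instance_def by blast
    have rp: "(r n)\<^sup>2 \<le> r_patch_sq C (opnorm (Ob n)) (omega_max (H n) (S n) (M n) (p n))
       (\<Sum>q\<in>{..<m n} - {p n}. (omega_max (H n) (S n) (M n) q)\<^sup>2)"
      by (rule le_r_patch_sq[OF C0 _ on0 on omega_max_nonneg[OF qc] om[OF p] sum_nonneg sumW mm small])
        (auto simp: C_def intro: c_p_le[OF qc p])
    have "1 / (bb * N ^ (4 * k + 2 * k4) * mm\<^sup>2) = 1/72 * (1 / (a4 * N ^ k4))\<^sup>2 * r n ^ 4"
    proof -
      have "r n ^ 4 = c1 ^ 4 / (N ^ (4 * k) * mm\<^sup>2)"
        using power_mult[of "r n" 2 2] unfolding rsq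
        by (simp add: power_divide power_mult_distrib power_mult[symmetric] mult.commute)
      then show ?thesis
        using a4 c1 by (simp add: bb_def power_add power_mult_distrib power_divide power_mult[symmetric] mult.commute)
    qed
    also have "\<dots> \<le> 1/72 * C\<^sup>2 * r n ^ 4"
      using C a4 N r0 by (intro mult_right_mono mult_left_mono power_mono) auto
    also have "\<dots> \<le> variance_on (unif_box (m n) (\<phi> n) (r n)) (loss n (\<rho> n) (Ob n) (V n) (H n) (S n) (M n))"
      using variance_loss_ge_patch[OF qc p r0 rp[unfolded C_def]] by (simp add: C_def)
    finally show ?case by (simp add: N_def mm_def)
  qed
  \<comment> \<open>r is an exact multiple of the rate, so c1 serves as both constants of the
    two-sided bound.\<close>
  then have "\<forall>\<^sub>F n in sequentially.
            c1 / (real (n + 1) ^ k * sqrt (real (m n))) \<le> r n \<and>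
            r n \<le> c1 / (real (n + 1) ^ k * sqrt (real (m n))) \<and>
            variance_on (unif_box (m n) (\<phi> n) (r n)) (loss n (\<rho> n) (Ob n) (V n) (H n) (S n) (M n))
              \<ge> 1 / (bb * real (n + 1) ^ (4 * k + 2 * k4) * (real (m n))\<^sup>2)"
    by (simp add: r_def)
  then show ?thesis using c1 bb by blast
qed

theorem theorem4:
  shows
  "(\<forall>n \<rho> Ob V H M m S \<phi> p.
      qc_instance n \<rho> Ob V H M m S \<and> p < m \<longrightarrow>
      (let c = c_p n \<rho> Ob V H S M \<phi> p;
           on = opnorm Ob;
           wp = omega_max H S M p;
           s = (\<Sum>q\<in>{..<m} - {p}. (omega_max H S M q)\<^sup>2);
           L = loss n \<rho> Ob V H S M;
           rp2 = r_patch_sq c on wp s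
       in (\<forall>r>0. r\<^sup>2 \<le> rp2 \<longrightarrow>
             variance_on (unif_box m \<phi> r) L \<ge>
               r ^ 4 / 45 * ((c - 8/3 * on * wp\<^sup>2 * s * r\<^sup>2)\<^sup>2 - 32/3 * on\<^sup>2 * wp ^ 6 * r\<^sup>2))
          \<and> variance_on (unif_box m \<phi> (sqrt rp2)) L \<ge> 1/72 * c\<^sup>2 * rp2\<^sup>2))
   \<and>
   (\<forall>(\<rho>::nat \<Rightarrow> complex mat) (Ob::nat \<Rightarrow> complex mat) (V::nat \<Rightarrow> nat \<Rightarrow> complex mat)
      (H::nat \<Rightarrow> nat \<Rightarrow> complex mat) (M::nat \<Rightarrow> nat) (m::nat \<Rightarrow> nat) (S::nat \<Rightarrow> nat \<Rightarrow> nat)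
      (\<phi>::nat \<Rightarrow> nat \<Rightarrow> real) (p::nat \<Rightarrow> nat).
      (\<forall>n. qc_instance n (\<rho> n) (Ob n) (V n) (H n) (M n) (m n) (S n) \<and> p n < m n)
      \<and> (\<exists>a k. \<forall>\<^sub>F n in sequentially. opnorm (Ob n) \<le> a * real (n + 1) ^ k)
      \<and> (\<exists>a k. \<forall>\<^sub>F n in sequentially. \<forall>l < M n. opnorm (H n l) \<le> a * real (n + 1) ^ k)
      \<and> (\<exists>a k. \<forall>\<^sub>F n in sequentially.
             \<forall>q < m n. real (card {l. l < M n \<and> S n l = q}) \<le> a * real (n + 1) ^ k)
      \<and> (\<exists>a k. a > 0 \<and> (\<forall>\<^sub>F n in sequentially.
             c_p n (\<rho> n) (Ob n) (V n) (H n) (S n) (M n) (\<phi> n) (p n) \<ge> 1 / (a * real (n + 1) ^ k)))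
      \<longrightarrow>
      (\<exists>(r::nat \<Rightarrow> real) k c1 c2 b j. c1 > 0 \<and> c2 > 0 \<and> b > 0 \<and>
         (\<forall>\<^sub>F n in sequentially.
            c1 / (real (n + 1) ^ k * sqrt (real (m n))) \<le> r n \<and>
            r n \<le> c2 / (real (n + 1) ^ k * sqrt (real (m n))) \<and>
            variance_on (unif_box (m n) (\<phi> n) (r n)) (loss n (\<rho> n) (Ob n) (V n) (H n) (S n) (M n))
              \<ge> 1 / (b * real (n + 1) ^ j * (real (m n))\<^sup>2))))"
proof (intro conjI allI impI)
  fix n \<rho> Ob V H M m S \<phi> p
  assume "qc_instance n \<rho> Ob V H M m S \<and> p < m"
  then have qc: "qc_instance n \<rho> Ob V H M m S" and p: "p < m" by auto
  define c where "c = c_p n \<rho> Ob V H S M \<phi> p"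
  define wp where "wp = omega_max H S M p"
  define s where "s = (\<Sum>q\<in>{..<m} - {p}. (omega_max H S M q)\<^sup>2)"
  define rp2 where "rp2 = r_patch_sq c (opnorm Ob) wp s"
  have on: "0 \<le> opnorm Ob" using qc opnorm_nonneg unfolding qc_instance_def by blast
  have rp0: "0 \<le> rp2"
    unfolding rp2_def r_patch_sq_def using on c_p_nonneg[of n \<rho> Ob V H S M \<phi> p]
    by (intro divide_nonneg_nonneg) (auto simp: c_def s_def sum_nonneg zero_le_even_power)
  have "1/72 * c\<^sup>2 * rp2\<^sup>2 \<le> variance_on (unif_box m \<phi> (sqrt rp2)) (loss n \<rho> Ob V H S M)"
  proof (cases "rp2 = 0")
    case True
    \<comment> \<open>This case is c = 0, since otherwise \<open>c_p_le\<close> makes the patch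
      radius positive. The box of radius 0 is degenerate, but the claimed bound is 0 and the
      variance is the integral of a square.\<close>
    then show ?thesis by (simp add: variance_on_def)
  next
    case False
    then have pos: "0 < sqrt rp2" using rp0 by simp
    have "(sqrt rp2) ^ 4 = rp2\<^sup>2"
      using rp0 power_mult[of "sqrt rp2" 2 2] by simp
    then show ?thesis
      using variance_loss_ge_patch[OF qc p pos] rp0
      unfolding rp2_def wp_def s_def c_def by simp
  qed
  then show "let c = c_p n \<rho> Ob V H S M \<phi> p; on = opnorm Ob; wp = omega_max H S M p;
           s = (\<Sum>q\<in>{..<m} - {p}. (omega_max H S M q)\<^sup>2);
           L = loss n \<rho> Ob V H S M; rp2 = r_patch_sq c on wp s
       in (\<forall>r>0. r\<^sup>2 \<le> rp2 \<longrightarrow>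
             variance_on (unif_box m \<phi> r) L \<ge>
               r ^ 4 / 45 * ((c - 8/3 * on * wp\<^sup>2 * s * r\<^sup>2)\<^sup>2 - 32/3 * on\<^sup>2 * wp ^ 6 * r\<^sup>2))
          \<and> variance_on (unif_box m \<phi> (sqrt rp2)) L \<ge> 1/72 * c\<^sup>2 * rp2\<^sup>2"
    using variance_loss_ge[OF qc p] unfolding Let_def rp2_def wp_def s_def c_def by blast
qed (elim conjE exE, rule variance_loss_scaling, blast+)

end
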